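(* For every first-order formula $F$ built from atomic (prime) formulas using $\wedge,\vee,\to,\forall,\exists$, there is a formula $e\in\Sigma\cup\Pi$ with $F\cong e$, where the classes $\Sigma,\Pi,\mathcal{B}$ are defined simultaneously by \begin{align*} \Sigma\ni d &::= c_1\vee\cdots\vee c_n \quad(n\ge2,\ c_i\in\Pi),\\ \Pi\ni c &::= \forall x_1(c_1\to b_1)\wedge\cdots\wedge\forall x_n(c_n\to b_n)\quad(n\ge0,\ c_i\in\Pi,\ b_i\in\mathcal{B}),\\ \mathcal{B}\ni b &::= p ~|~ d ~|~ \exists x\, c \quad(d\in\Sigma,\ c\in\Pi), \end{align*} where $p$ denotes a prime formula and each $x$, $x_i$ denotes a (possibly empty) list of first-order variables, $\forall x$ and $\exists x$ standing for the corresponding blocks of quantifiers. In extended exponential-polynomial notation (writing $\exists x F$ as $xF$ and $\forall x F$ as $F^x$): $d=\sum_{i=1}^{n\ge2}c_i$, $c=\prod_{i=1}^{n\ge0}(b_i^{c_i})^{x_i}$, $b::=p~|~d~|~xc$.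
   Context: The nullary conjunction ($n=0$ in $\Pi$) is the formula $\top$. Two formulas $F,G$ are isomorphic, $F\cong G$, if there are proof terms $\phi$ of $F\to G$ and $\psi$ of $G\to F$ in the natural-deduction $\lambda$-calculus for intuitionistic (minimal) first-order logic (with product, sum and unit types, $\forall$-introduction $\lambda x.p$ and elimination $p\,t$, $\exists$-introduction $\langle t,p\rangle$ and elimination $\mathrm{dest}\ p\ \mathrm{as}\ \langle x,b\rangle\ \mathrm{in}\ q$) such that $\lambda a.\psi(\phi\,a)=_{\beta\eta}\lambda a.a$ and $\lambda c.\phi(\psi\,c)=_{\beta\eta}\lambda c.c$. Here $=_{\beta\eta}$ is the usual $\beta\eta$-equality for the propositional connectives, extended with $(\lambda x.p)t=_\beta p\{t/x\}$, $\mathrm{dest}\ \langle t,p\rangle\ \mathrm{as}\ \langle x,a\rangle\ \mathrm{in}\ q=_\beta q\{t/x\}\{p/a\}$, $p=_\eta\lambda x.p\,x$, and $p\{q/a\}=_\eta\mathrm{dest}\ q\ \mathrm{as}\ \langle x,b\rangle\ \mathrm{in}\ p\{\langle x,b\rangle/a\}$. *)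

theory Defs
  imports Main
begin

text \<open>
  Intuitionistic (minimal) first-order logic over an arbitrary signature: \<open>'f\<close> are the function
  symbols, \<open>'p\<close> the predicate symbols, and a symbol may be used with any number of arguments.
  Binding is by de Bruijn indices, with separate index spaces for individual variables (\<open>Var\<close>)
  and for hypothesis variables of proof terms (\<open>Hyp\<close>). Thus formulas and proof terms are
  identified up to renaming of bound variables, and a block of quantifiers over a list of
  \<open>k\<close> variables is \<open>Forall ^^ k\<close> or \<open>Exists ^^ k\<close>.
\<close>

datatype 'f tm = Var nat | Fn 'f "'f tm list"

datatype ('f, 'p) fm =
    Prime 'p "'f tm list"
  | Top
  | And "('f, 'p) fm" "('f, 'p) fm"
  | Or "('f, 'p) fm" "('f, 'p) fm"
  | Imp "('f, 'p) fm" "('f, 'p) fm"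
  | Forall "('f, 'p) fm"
  | Exists "('f, 'p) fm"

fun top_free :: "('f, 'p) fm \<Rightarrow> bool" where
  "top_free (Prime P ts) \<longleftrightarrow> True"
| "top_free Top \<longleftrightarrow> False"
| "top_free (And A B) \<longleftrightarrow> top_free A \<and> top_free B"
| "top_free (Or A B) \<longleftrightarrow> top_free A \<and> top_free B"
| "top_free (Imp A B) \<longleftrightarrow> top_free A \<and> top_free B"
| "top_free (Forall A) \<longleftrightarrow> top_free A"
| "top_free (Exists A) \<longleftrightarrow> top_free A"

text \<open>
  \<open>Case p q r\<close> binds hypothesis 0 in \<open>q\<close> and in \<open>r\<close>; \<open>Lam\<close> binds hypothesis 0;
  \<open>TLam\<close> binds individual variable 0; \<open>Dest p q\<close>, i.e. \<open>dest p as (x, a) in q\<close>, binds both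
  individual variable 0 and hypothesis 0 in \<open>q\<close>.
\<close>

datatype 'f pt =
    Hyp nat
  | Unit
  | MkPair "'f pt" "'f pt"
  | Fst "'f pt"
  | Snd "'f pt"
  | InjL "'f pt"
  | InjR "'f pt"
  | Case "'f pt" "'f pt" "'f pt"
  | Lam "'f pt"
  | App "'f pt" "'f pt"
  | TLam "'f pt"
  | TApp "'f pt" "'f tm"
  | TPair "'f tm" "'f pt"
  | Dest "'f pt" "'f pt"

subsection \<open>Substitution of individual terms\<close>

primrec sub_tm :: "(nat \<Rightarrow> 'f tm) \<Rightarrow> 'f tm \<Rightarrow> 'f tm" where
  "sub_tm s (Var n) = s n"
| "sub_tm s (Fn f ts) = Fn f (map (sub_tm s) ts)"

definition shift :: "nat \<Rightarrow> 'f tm" where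
  "shift n = Var (Suc n)"

definition inst :: "'f tm \<Rightarrow> nat \<Rightarrow> 'f tm" where
  "inst t = case_nat t Var"

text \<open>\<open>up\<close> carries a substitution under a binder of an individual variable.\<close>

definition up :: "(nat \<Rightarrow> 'f tm) \<Rightarrow> nat \<Rightarrow> 'f tm" where
  "up s = case_nat (Var 0) (\<lambda>n. sub_tm shift (s n))"

primrec sub_fm :: "(nat \<Rightarrow> 'f tm) \<Rightarrow> ('f, 'p) fm \<Rightarrow> ('f, 'p) fm" where
  "sub_fm s (Prime P ts) = Prime P (map (sub_tm s) ts)"
| "sub_fm s Top = Top"
| "sub_fm s (And A B) = And (sub_fm s A) (sub_fm s B)"
| "sub_fm s (Or A B) = Or (sub_fm s A) (sub_fm s B)"
| "sub_fm s (Imp A B) = Imp (sub_fm s A) (sub_fm s B)"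
| "sub_fm s (Forall A) = Forall (sub_fm (up s) A)"
| "sub_fm s (Exists A) = Exists (sub_fm (up s) A)"

primrec tsub_pt :: "(nat \<Rightarrow> 'f tm) \<Rightarrow> 'f pt \<Rightarrow> 'f pt" where
  "tsub_pt s (Hyp n) = Hyp n"
| "tsub_pt s Unit = Unit"
| "tsub_pt s (MkPair p q) = MkPair (tsub_pt s p) (tsub_pt s q)"
| "tsub_pt s (Fst p) = Fst (tsub_pt s p)"
| "tsub_pt s (Snd p) = Snd (tsub_pt s p)"
| "tsub_pt s (InjL p) = InjL (tsub_pt s p)"
| "tsub_pt s (InjR p) = InjR (tsub_pt s p)"
| "tsub_pt s (Case p q r) = Case (tsub_pt s p) (tsub_pt s q) (tsub_pt s r)"
| "tsub_pt s (Lam p) = Lam (tsub_pt s p)"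
| "tsub_pt s (App p q) = App (tsub_pt s p) (tsub_pt s q)"
| "tsub_pt s (TLam p) = TLam (tsub_pt (up s) p)"
| "tsub_pt s (TApp p t) = TApp (tsub_pt s p) (sub_tm s t)"
| "tsub_pt s (TPair t p) = TPair (sub_tm s t) (tsub_pt s p)"
| "tsub_pt s (Dest p q) = Dest (tsub_pt s p) (tsub_pt (up s) q)"

subsection \<open>Substitution of proof terms for hypotheses\<close>

definition upr :: "(nat \<Rightarrow> nat) \<Rightarrow> nat \<Rightarrow> nat" where
  "upr r = case_nat 0 (\<lambda>n. Suc (r n))"

primrec ren_pt :: "(nat \<Rightarrow> nat) \<Rightarrow> 'f pt \<Rightarrow> 'f pt" where
  "ren_pt r (Hyp n) = Hyp (r n)"
| "ren_pt r Unit = Unit"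
| "ren_pt r (MkPair p q) = MkPair (ren_pt r p) (ren_pt r q)"
| "ren_pt r (Fst p) = Fst (ren_pt r p)"
| "ren_pt r (Snd p) = Snd (ren_pt r p)"
| "ren_pt r (InjL p) = InjL (ren_pt r p)"
| "ren_pt r (InjR p) = InjR (ren_pt r p)"
| "ren_pt r (Case p q q') = Case (ren_pt r p) (ren_pt (upr r) q) (ren_pt (upr r) q')"
| "ren_pt r (Lam p) = Lam (ren_pt (upr r) p)"
| "ren_pt r (App p q) = App (ren_pt r p) (ren_pt r q)"
| "ren_pt r (TLam p) = TLam (ren_pt r p)"
| "ren_pt r (TApp p t) = TApp (ren_pt r p) t"
| "ren_pt r (TPair t p) = TPair t (ren_pt r p)"
| "ren_pt r (Dest p q) = Dest (ren_pt r p) (ren_pt (upr r) q)"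

text \<open>
  \<open>uph\<close> and \<open>uptm\<close> carry a substitution for hypotheses under a binder of a hypothesis and of an
  individual variable, respectively.
\<close>

definition uph :: "(nat \<Rightarrow> 'f pt) \<Rightarrow> nat \<Rightarrow> 'f pt" where
  "uph s = case_nat (Hyp 0) (\<lambda>n. ren_pt Suc (s n))"

definition uptm :: "(nat \<Rightarrow> 'f pt) \<Rightarrow> nat \<Rightarrow> 'f pt" where
  "uptm s = (\<lambda>n. tsub_pt shift (s n))"

primrec sub_pt :: "(nat \<Rightarrow> 'f pt) \<Rightarrow> 'f pt \<Rightarrow> 'f pt" where
  "sub_pt s (Hyp n) = s n"
| "sub_pt s Unit = Unit"
| "sub_pt s (MkPair p q) = MkPair (sub_pt s p) (sub_pt s q)"
| "sub_pt s (Fst p) = Fst (sub_pt s p)"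
| "sub_pt s (Snd p) = Snd (sub_pt s p)"
| "sub_pt s (InjL p) = InjL (sub_pt s p)"
| "sub_pt s (InjR p) = InjR (sub_pt s p)"
| "sub_pt s (Case p q r) = Case (sub_pt s p) (sub_pt (uph s) q) (sub_pt (uph s) r)"
| "sub_pt s (Lam p) = Lam (sub_pt (uph s) p)"
| "sub_pt s (App p q) = App (sub_pt s p) (sub_pt s q)"
| "sub_pt s (TLam p) = TLam (sub_pt (uptm s) p)"
| "sub_pt s (TApp p t) = TApp (sub_pt s p) t"
| "sub_pt s (TPair t p) = TPair t (sub_pt s p)"
| "sub_pt s (Dest p q) = Dest (sub_pt s p) (sub_pt (uph (uptm s)) q)"

text \<open>\<open>subst0 q p\<close> is \<open>p{q/a}\<close> where \<open>a\<close> is hypothesis 0 of \<open>p\<close>, which is discharged.\<close>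

definition subst0 :: "'f pt \<Rightarrow> 'f pt \<Rightarrow> 'f pt" where
  "subst0 q = sub_pt (case_nat q Hyp)"

text \<open>\<open>replace0 q p\<close> is \<open>p{q/a}\<close> where \<open>q\<close> itself lives under a new hypothesis 0.\<close>

definition replace0 :: "'f pt \<Rightarrow> 'f pt \<Rightarrow> 'f pt" where
  "replace0 q = sub_pt (case_nat q (\<lambda>n. Hyp (Suc n)))"

subsection \<open>Natural deduction\<close>

text \<open>
  A context is the list of the formulas of the open hypotheses, hypothesis 0 first. Shifting the
  context in \<open>AllI\<close> and \<open>ExE\<close> (and \<open>C\<close> in \<open>ExE\<close>) expresses the eigenvariable conditions.
\<close>

inductive proves :: "('f, 'p) fm list \<Rightarrow> 'f pt \<Rightarrow> ('f, 'p) fm \<Rightarrow> bool"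
  ("(_ \<turnstile>/ _ \<Colon>/ _)" [51, 51, 51] 50) where
  Hyp: "n < length \<Gamma> \<Longrightarrow> \<Gamma> \<turnstile> Hyp n \<Colon> \<Gamma> ! n"
| TopI: "\<Gamma> \<turnstile> Unit \<Colon> Top"
| AndI: "\<Gamma> \<turnstile> p \<Colon> A \<Longrightarrow> \<Gamma> \<turnstile> q \<Colon> B \<Longrightarrow> \<Gamma> \<turnstile> MkPair p q \<Colon> And A B"
| AndE1: "\<Gamma> \<turnstile> p \<Colon> And A B \<Longrightarrow> \<Gamma> \<turnstile> Fst p \<Colon> A"
| AndE2: "\<Gamma> \<turnstile> p \<Colon> And A B \<Longrightarrow> \<Gamma> \<turnstile> Snd p \<Colon> B"
| OrI1: "\<Gamma> \<turnstile> p \<Colon> A \<Longrightarrow> \<Gamma> \<turnstile> InjL p \<Colon> Or A B"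
| OrI2: "\<Gamma> \<turnstile> p \<Colon> B \<Longrightarrow> \<Gamma> \<turnstile> InjR p \<Colon> Or A B"
| OrE: "\<Gamma> \<turnstile> p \<Colon> Or A B \<Longrightarrow> A # \<Gamma> \<turnstile> q \<Colon> C \<Longrightarrow> B # \<Gamma> \<turnstile> r \<Colon> C \<Longrightarrow> \<Gamma> \<turnstile> Case p q r \<Colon> C"
| ImpI: "A # \<Gamma> \<turnstile> p \<Colon> B \<Longrightarrow> \<Gamma> \<turnstile> Lam p \<Colon> Imp A B"
| ImpE: "\<Gamma> \<turnstile> p \<Colon> Imp A B \<Longrightarrow> \<Gamma> \<turnstile> q \<Colon> A \<Longrightarrow> \<Gamma> \<turnstile> App p q \<Colon> B"
| AllI: "map (sub_fm shift) \<Gamma> \<turnstile> p \<Colon> A \<Longrightarrow> \<Gamma> \<turnstile> TLam p \<Colon> Forall A"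
| AllE: "\<Gamma> \<turnstile> p \<Colon> Forall A \<Longrightarrow> \<Gamma> \<turnstile> TApp p t \<Colon> sub_fm (inst t) A"
| ExI: "\<Gamma> \<turnstile> p \<Colon> sub_fm (inst t) A \<Longrightarrow> \<Gamma> \<turnstile> TPair t p \<Colon> Exists A"
| ExE: "\<Gamma> \<turnstile> p \<Colon> Exists A \<Longrightarrow> A # map (sub_fm shift) \<Gamma> \<turnstile> q \<Colon> sub_fm shift C \<Longrightarrow> \<Gamma> \<turnstile> Dest p q \<Colon> C"

subsection \<open>Beta-eta equality\<close>

text \<open>
  Proof terms carry no type annotations, and the eta rules depend on the formula proved; equality
  is therefore a relation between proofs of the same formula in the same context. It is the
  least congruence containing the beta and eta laws.
\<close>

inductive bee :: "('f, 'p) fm list \<Rightarrow> 'f pt \<Rightarrow> 'f pt \<Rightarrow> ('f, 'p) fm \<Rightarrow> bool"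
  ("(_ \<turnstile>/ _ \<approx>/ _ \<Colon>/ _)" [51, 51, 51, 51] 50) where
  bee_refl: "\<Gamma> \<turnstile> p \<Colon> A \<Longrightarrow> \<Gamma> \<turnstile> p \<approx> p \<Colon> A"
| bee_sym: "\<Gamma> \<turnstile> p \<approx> q \<Colon> A \<Longrightarrow> \<Gamma> \<turnstile> q \<approx> p \<Colon> A"
| bee_trans: "\<Gamma> \<turnstile> p \<approx> q \<Colon> A \<Longrightarrow> \<Gamma> \<turnstile> q \<approx> r \<Colon> A \<Longrightarrow> \<Gamma> \<turnstile> p \<approx> r \<Colon> A"
| cong_Pair: "\<Gamma> \<turnstile> p \<approx> p' \<Colon> A \<Longrightarrow> \<Gamma> \<turnstile> q \<approx> q' \<Colon> B \<Longrightarrow> \<Gamma> \<turnstile> MkPair p q \<approx> MkPair p' q' \<Colon> And A B"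
| cong_Fst: "\<Gamma> \<turnstile> p \<approx> p' \<Colon> And A B \<Longrightarrow> \<Gamma> \<turnstile> Fst p \<approx> Fst p' \<Colon> A"
| cong_Snd: "\<Gamma> \<turnstile> p \<approx> p' \<Colon> And A B \<Longrightarrow> \<Gamma> \<turnstile> Snd p \<approx> Snd p' \<Colon> B"
| cong_Inl: "\<Gamma> \<turnstile> p \<approx> p' \<Colon> A \<Longrightarrow> \<Gamma> \<turnstile> InjL p \<approx> InjL p' \<Colon> Or A B"
| cong_Inr: "\<Gamma> \<turnstile> p \<approx> p' \<Colon> B \<Longrightarrow> \<Gamma> \<turnstile> InjR p \<approx> InjR p' \<Colon> Or A B"
| cong_Case: "\<Gamma> \<turnstile> p \<approx> p' \<Colon> Or A B \<Longrightarrow> A # \<Gamma> \<turnstile> q \<approx> q' \<Colon> C \<Longrightarrow> B # \<Gamma> \<turnstile> r \<approx> r' \<Colon> C \<Longrightarrow>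
    \<Gamma> \<turnstile> Case p q r \<approx> Case p' q' r' \<Colon> C"
| cong_Lam: "A # \<Gamma> \<turnstile> p \<approx> p' \<Colon> B \<Longrightarrow> \<Gamma> \<turnstile> Lam p \<approx> Lam p' \<Colon> Imp A B"
| cong_App: "\<Gamma> \<turnstile> p \<approx> p' \<Colon> Imp A B \<Longrightarrow> \<Gamma> \<turnstile> q \<approx> q' \<Colon> A \<Longrightarrow> \<Gamma> \<turnstile> App p q \<approx> App p' q' \<Colon> B"
| cong_TLam: "map (sub_fm shift) \<Gamma> \<turnstile> p \<approx> p' \<Colon> A \<Longrightarrow> \<Gamma> \<turnstile> TLam p \<approx> TLam p' \<Colon> Forall A"
| cong_TApp: "\<Gamma> \<turnstile> p \<approx> p' \<Colon> Forall A \<Longrightarrow> \<Gamma> \<turnstile> TApp p t \<approx> TApp p' t \<Colon> sub_fm (inst t) A"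
| cong_TPair: "\<Gamma> \<turnstile> p \<approx> p' \<Colon> sub_fm (inst t) A \<Longrightarrow> \<Gamma> \<turnstile> TPair t p \<approx> TPair t p' \<Colon> Exists A"
| cong_Dest: "\<Gamma> \<turnstile> p \<approx> p' \<Colon> Exists A \<Longrightarrow> A # map (sub_fm shift) \<Gamma> \<turnstile> q \<approx> q' \<Colon> sub_fm shift C \<Longrightarrow>
    \<Gamma> \<turnstile> Dest p q \<approx> Dest p' q' \<Colon> C"
| beta_Fst: "\<Gamma> \<turnstile> p \<Colon> A \<Longrightarrow> \<Gamma> \<turnstile> q \<Colon> B \<Longrightarrow> \<Gamma> \<turnstile> Fst (MkPair p q) \<approx> p \<Colon> A"
| beta_Snd: "\<Gamma> \<turnstile> p \<Colon> A \<Longrightarrow> \<Gamma> \<turnstile> q \<Colon> B \<Longrightarrow> \<Gamma> \<turnstile> Snd (MkPair p q) \<approx> q \<Colon> B"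
| beta_Inl: "\<Gamma> \<turnstile> p \<Colon> A \<Longrightarrow> A # \<Gamma> \<turnstile> q \<Colon> C \<Longrightarrow> B # \<Gamma> \<turnstile> r \<Colon> C \<Longrightarrow>
    \<Gamma> \<turnstile> Case (InjL p) q r \<approx> subst0 p q \<Colon> C"
| beta_Inr: "\<Gamma> \<turnstile> p \<Colon> B \<Longrightarrow> A # \<Gamma> \<turnstile> q \<Colon> C \<Longrightarrow> B # \<Gamma> \<turnstile> r \<Colon> C \<Longrightarrow>
    \<Gamma> \<turnstile> Case (InjR p) q r \<approx> subst0 p r \<Colon> C"
| beta_Imp: "A # \<Gamma> \<turnstile> p \<Colon> B \<Longrightarrow> \<Gamma> \<turnstile> q \<Colon> A \<Longrightarrow> \<Gamma> \<turnstile> App (Lam p) q \<approx> subst0 q p \<Colon> B"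
| beta_Forall: "map (sub_fm shift) \<Gamma> \<turnstile> p \<Colon> A \<Longrightarrow>
    \<Gamma> \<turnstile> TApp (TLam p) t \<approx> tsub_pt (inst t) p \<Colon> sub_fm (inst t) A"
| beta_Exists: "\<Gamma> \<turnstile> p \<Colon> sub_fm (inst t) A \<Longrightarrow> A # map (sub_fm shift) \<Gamma> \<turnstile> q \<Colon> sub_fm shift C \<Longrightarrow>
    \<Gamma> \<turnstile> Dest (TPair t p) q \<approx> subst0 p (tsub_pt (inst t) q) \<Colon> C"
| eta_Top: "\<Gamma> \<turnstile> p \<Colon> Top \<Longrightarrow> \<Gamma> \<turnstile> p \<approx> Unit \<Colon> Top"
| eta_And: "\<Gamma> \<turnstile> p \<Colon> And A B \<Longrightarrow> \<Gamma> \<turnstile> p \<approx> MkPair (Fst p) (Snd p) \<Colon> And A B"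
| eta_Or: "\<Gamma> \<turnstile> q \<Colon> Or A B \<Longrightarrow> Or A B # \<Gamma> \<turnstile> p \<Colon> C \<Longrightarrow>
    \<Gamma> \<turnstile> subst0 q p \<approx> Case q (replace0 (InjL (Hyp 0)) p) (replace0 (InjR (Hyp 0)) p) \<Colon> C"
| eta_Imp: "\<Gamma> \<turnstile> p \<Colon> Imp A B \<Longrightarrow> \<Gamma> \<turnstile> p \<approx> Lam (App (ren_pt Suc p) (Hyp 0)) \<Colon> Imp A B"
| eta_Forall: "\<Gamma> \<turnstile> p \<Colon> Forall A \<Longrightarrow> \<Gamma> \<turnstile> p \<approx> TLam (TApp (tsub_pt shift p) (Var 0)) \<Colon> Forall A"
| eta_Exists: "\<Gamma> \<turnstile> q \<Colon> Exists A \<Longrightarrow> Exists A # \<Gamma> \<turnstile> p \<Colon> C \<Longrightarrow>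
    \<Gamma> \<turnstile> subst0 q p \<approx> Dest q (replace0 (TPair (Var 0) (Hyp 0)) (tsub_pt shift p)) \<Colon> C"

text \<open>In the composites, \<open>ren_pt Suc\<close> weakens \<open>\<phi>\<close> and \<open>\<psi>\<close> by the bound hypothesis.\<close>

definition isomorphic :: "('f, 'p) fm \<Rightarrow> ('f, 'p) fm \<Rightarrow> bool" (infix "\<cong>" 50) where
  "F \<cong> G \<longleftrightarrow> (\<exists>\<phi> \<psi>. [] \<turnstile> \<phi> \<Colon> Imp F G \<and> [] \<turnstile> \<psi> \<Colon> Imp G F \<and>
     [] \<turnstile> Lam (App (ren_pt Suc \<psi>) (App (ren_pt Suc \<phi>) (Hyp 0))) \<approx> Lam (Hyp 0) \<Colon> Imp F F \<and>
     [] \<turnstile> Lam (App (ren_pt Suc \<phi>) (App (ren_pt Suc \<psi>) (Hyp 0))) \<approx> Lam (Hyp 0) \<Colon> Imp G G)"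

subsection \<open>The formula classes\<close>

text \<open>
  Iterated disjunctions and conjunctions are nested to the right. A one-element list yields its
  only member; \<open>Disj []\<close> is left unspecified, since there is no falsity, and is never used.
\<close>

fun Disj :: "('f, 'p) fm list \<Rightarrow> ('f, 'p) fm" where
  "Disj [A] = A"
| "Disj (A # B # As) = Or A (Disj (B # As))"

fun Conj :: "('f, 'p) fm list \<Rightarrow> ('f, 'p) fm" where
  "Conj [] = Top"
| "Conj [A] = A"
| "Conj (A # B # As) = And A (Conj (B # As))"

text \<open>
  A triple \<open>(k, c, b)\<close> stands for the conjunct \<open>\<forall>x. (c \<rightarrow> b)\<close> with \<open>x\<close> a list of \<open>k\<close> variables.
\<close>

inductive_set
  SigmaF :: "('f, 'p) fm set" and
  PiF :: "('f, 'p) fm set" and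
  BaseF :: "('f, 'p) fm set"
where
  Sigma_Disj: "length cs \<ge> 2 \<Longrightarrow> \<forall>c \<in> set cs. c \<in> PiF \<Longrightarrow> Disj cs \<in> SigmaF"
| Pi_Conj: "\<forall>k c b. (k, c, b) \<in> set ts \<longrightarrow> c \<in> PiF \<and> b \<in> BaseF \<Longrightarrow>
    Conj (map (\<lambda>(k, c, b). (Forall ^^ k) (Imp c b)) ts) \<in> PiF"
| Base_Prime: "Prime P us \<in> BaseF"
| Base_Sigma: "d \<in> SigmaF \<Longrightarrow> d \<in> BaseF"
| Base_Exists: "c \<in> PiF \<Longrightarrow> (Exists ^^ k) c \<in> BaseF"

end

(* Every formula is isomorphic to one in PiF: a disjunction or existential formula b of BaseF is
   isomorphic to the clause Top -> b, and PiF is closed up to isomorphism under the negative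
   connectives by the identities C -> (A /\ B) = (C -> A) /\ (C -> B), C -> (D -> B) = C /\ D -> B,
   C -> ALL x. A = ALL x. (C -> A), ALL x. (A /\ B) = (ALL x. A) /\ (ALL x. B) and their nullary
   versions. Induction on the formula then only needs that isomorphism is a congruence. *)

theory Submission
  imports Defs
begin

text \<open>Equality is typed and carries its context, so rewriting inside equations would call for
  weakening and substitution lemmas for \<open>\<approx>\<close>. Isomorphisms are therefore given
  by closed terms whose composites are the identity in every context, and such an equation is
  instantiated at a term u inside the calculus: abstract, apply both sides to u, beta-reduce. Only
  typing gets substitution lemmas. The other equations are settled by computation: extensionality
  splits them along the formula, and both sides are evaluated to the same term. For disjunction and
  existence, eta says instead that a term depending on a hypothesis is determined by its values on
  injections or pairs, which settles their congruence. Moving a premise under a quantifier shifts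
  its variables, so the three classes must also be closed under substitution of individual
  terms.\<close>

section \<open>Algebra of substitutions of individual terms\<close>

lemma sub_tm_comp: "sub_tm s (sub_tm s' t) = sub_tm (\<lambda>n. sub_tm s (s' n)) t"
  by (induction t) auto

lemma sub_tm_Var [simp]: "sub_tm Var t = t"
  by (induction t) (auto simp: map_idI)

lemma inst_simps [simp]: "inst t 0 = t" "inst t (Suc n) = Var n"
  by (simp_all add: inst_def)

lemma up_simps [simp]: "up s 0 = Var 0" "up s (Suc n) = sub_tm shift (s n)"
  by (simp_all add: up_def)

lemma up_Var [simp]: "up Var = Var"
  by (rule ext) (simp add: up_def shift_def split: nat.split)

lemma up_comp: "(\<lambda>n. sub_tm (up s) (up s' n)) = up (\<lambda>n. sub_tm s (s' n))"
  by (rule ext) (simp add: up_def sub_tm_comp shift_def split: nat.split)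

lemma sub_fm_comp: "sub_fm s (sub_fm s' A) = sub_fm (\<lambda>n. sub_tm s (s' n)) A"
  by (induction A arbitrary: s s') (simp_all add: sub_tm_comp up_comp)

lemma sub_fm_Var [simp]: "sub_fm Var A = A"
  by (induction A) (auto simp: map_idI)

lemma tsub_pt_comp: "tsub_pt s (tsub_pt s' p) = tsub_pt (\<lambda>n. sub_tm s (s' n)) p"
  by (induction p arbitrary: s s') (simp_all add: sub_tm_comp up_comp)

lemma tsub_pt_Var [simp]: "tsub_pt Var p = p"
  by (induction p) (auto simp: map_idI)

lemma inst_shift: "(\<lambda>n. sub_tm (inst t) (shift n)) = Var"
  by (simp add: shift_def)

text \<open>\<open>up shift\<close> fixes variable 0 and opens a gap at 1, which
  \<open>inst (Var 0)\<close> closes again. Hence a weakened quantified formula, opened at the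
  eigenvariable \<open>Var 0\<close>, gives back its original body.\<close>

lemma inst_up_shift: "(\<lambda>n. sub_tm (inst (Var 0)) (up shift n)) = Var"
  by (rule ext) (simp add: up_def shift_def inst_def split: nat.split)

lemma sub_fm_inst_shift [simp]: "sub_fm (inst t) (sub_fm shift A) = A"
  by (simp add: sub_fm_comp inst_shift)

lemma sub_fm_inst_up_shift [simp]: "sub_fm (inst (Var 0)) (sub_fm (up shift) A) = A"
  by (simp add: sub_fm_comp inst_up_shift)

lemma tsub_pt_inst_shift [simp]: "tsub_pt (inst t) (tsub_pt shift p) = p"
  by (simp add: tsub_pt_comp inst_shift)

lemma tsub_pt_inst_up_shift [simp]: "tsub_pt (inst (Var 0)) (tsub_pt (up shift) p) = p"
  by (simp add: tsub_pt_comp inst_up_shift)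

lemma sub_fm_up_shift: "sub_fm (up s) (sub_fm shift A) = sub_fm shift (sub_fm s A)"
  by (simp add: sub_fm_comp shift_def)

text \<open>Both sides send variable 0 to \<open>sub_tm s t\<close> and variable n+1 to
  \<open>s n\<close>. This is what \<open>AllE\<close> and \<open>ExI\<close> require in order to be
  stable under substitution.\<close>

lemma sub_fm_inst: "sub_fm s (sub_fm (inst t) A) = sub_fm (inst (sub_tm s t)) (sub_fm (up s) A)"
proof -
  have "(\<lambda>n. sub_tm s (inst t n)) = (\<lambda>n. sub_tm (inst (sub_tm s t)) (up s n))"
    by (rule ext) (simp add: up_def inst_def sub_tm_comp shift_def split: nat.split)
  then show ?thesis by (simp add: sub_fm_comp)
qed

section \<open>Renaming and substitution of hypotheses\<close>

lemma upr_simps [simp]: "upr r 0 = 0" "upr r (Suc n) = Suc (r n)"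
  by (simp_all add: upr_def)

lemma uph_simps [simp]: "uph s 0 = Hyp 0" "uph s (Suc n) = ren_pt Suc (s n)"
  by (simp_all add: uph_def)

text \<open>Serves to cancel a weakening against the substitution for the hypothesis it introduced,
  as happens whenever a beta redex contains a weakened term.\<close>

lemma sub_pt_ren: "sub_pt s (ren_pt r p) = sub_pt (\<lambda>n. s (r n)) p"
proof -
  have 1: "(\<lambda>n. uph s (upr r n)) = uph (\<lambda>n. s (r n))" for r and s :: "nat \<Rightarrow> 'a pt"
    by (rule ext) (simp add: uph_def upr_def split: nat.split)
  show ?thesis by (induction p arbitrary: r s) (simp_all add: 1 uptm_def)
qed

lemma sub_pt_Hyp [simp]: "sub_pt Hyp p = p"
proof -
  have 1: "uph Hyp = Hyp" by (rule ext) (simp add: uph_def split: nat.split)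
  have 2: "uptm Hyp = Hyp" by (simp add: uptm_def)
  show ?thesis by (induction p) (simp_all add: 1 2)
qed

lemma subst0_weaken [simp]: "sub_pt (case_nat q Hyp) (ren_pt Suc p) = p"
  by (simp add: sub_pt_ren)

subsection \<open>Admissible rules\<close>

lemma proves_ren:
  assumes "\<Gamma> \<turnstile> p \<Colon> A" "\<forall>n < length \<Gamma>. r n < length \<Delta> \<and> \<Delta> ! r n = \<Gamma> ! n"
  shows "\<Delta> \<turnstile> ren_pt r p \<Colon> A"
proof -
  have up: "\<forall>n < length (B # \<Gamma>). upr r n < length (B # \<Delta>) \<and> (B # \<Delta>) ! upr r n = (B # \<Gamma>) ! n"
    if "\<forall>n < length \<Gamma>. r n < length \<Delta> \<and> \<Delta> ! r n = \<Gamma> ! n"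
    for B r and \<Gamma> \<Delta> :: "('a, 'b) fm list"
    using that by (auto simp: upr_def split: nat.split)
  show ?thesis using assms
  proof (induction arbitrary: r \<Delta> rule: proves.induct)
    case (Hyp n \<Gamma>)
    then show ?case by (metis proves.Hyp ren_pt.simps(1))
  next
    case (OrE \<Gamma> p A B q C r')
    then show ?case
      using OrE.IH(1)[OF OrE.prems] OrE.IH(2,3)[OF up[OF OrE.prems]] by (auto intro: proves.OrE)
  next
    case (ImpI A \<Gamma> p B)
    then show ?case using ImpI.IH[OF up[OF ImpI.prems]] by (auto intro: proves.ImpI)
  next
    case (AllI \<Gamma> p A)
    then show ?case by (simp, intro proves.AllI) simp
  next
    case (ExE \<Gamma> p A q C)
    from ExE.IH(2)[OF up, of r "map (sub_fm shift) \<Delta>"] ExE.IH(1)[OF ExE.prems] ExE.prems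
    show ?case by (simp, intro proves.ExE) auto
  next
    case (ImpE \<Gamma> p A B q)
    show ?case
      using proves.ImpE[OF ImpE.IH(1)[OF ImpE.prems] ImpE.IH(2)[OF ImpE.prems]] by simp
  qed (auto intro: proves.intros)
qed

lemma proves_weaken: "\<Gamma> \<turnstile> p \<Colon> A \<Longrightarrow> B # \<Gamma> \<turnstile> ren_pt Suc p \<Colon> A"
  by (rule proves_ren) auto

text \<open>The induction runs over all \<open>s\<close>: a quantifier rule continues with
  \<open>up s\<close>, and \<open>sub_fm_up_shift\<close> moves the substitution past the context
  shift that encodes the eigenvariable condition.\<close>

lemma proves_tsub:
  assumes "\<Gamma> \<turnstile> p \<Colon> A"
  shows "map (sub_fm s) \<Gamma> \<turnstile> tsub_pt s p \<Colon> sub_fm s A"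
  using assms
proof (induction arbitrary: s rule: proves.induct)
  case (Hyp n \<Gamma>)
  then show ?case by (metis length_map nth_map proves.Hyp tsub_pt.simps(1))
next
  case (AllI \<Gamma> p A)
  then show ?case
    using AllI.IH[of "up s"] by (auto intro!: proves.AllI simp: comp_def sub_fm_up_shift)
next
  case (AllE \<Gamma> p A t)
  then show ?case using proves.AllE by (fastforce simp: sub_fm_inst)
next
  case (ExI \<Gamma> p t A)
  then show ?case by (auto intro!: proves.ExI simp: sub_fm_inst)
next
  case (ExE \<Gamma> p A q C)
  then show ?case
    using ExE.IH(1)[of s] ExE.IH(2)[of "up s"]
    by (auto intro!: proves.ExE simp: comp_def sub_fm_up_shift)
next
  case (ImpE \<Gamma> p A B q)
  then show ?case using proves.ImpE[of _ _ "sub_fm s A" "sub_fm s B"] by simp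
qed (auto intro: proves.intros)

text \<open>Passing a bound hypothesis weakens the substituted terms, passing a bound individual
  variable shifts them, so the proof rests on \<open>proves_weaken\<close> and
  \<open>proves_tsub\<close>.\<close>

lemma proves_sub:
  assumes "\<Gamma> \<turnstile> p \<Colon> A" "\<forall>n < length \<Gamma>. \<Delta> \<turnstile> s n \<Colon> \<Gamma> ! n"
  shows "\<Delta> \<turnstile> sub_pt s p \<Colon> A"
proof -
  have up: "\<forall>n < length (B # \<Gamma>). B # \<Delta> \<turnstile> uph s n \<Colon> (B # \<Gamma>) ! n"
    if "\<forall>n < length \<Gamma>. \<Delta> \<turnstile> s n \<Colon> \<Gamma> ! n"
    for B s and \<Gamma> \<Delta> :: "('a, 'b) fm list"
    using that proves.Hyp[of 0 "B # \<Delta>"]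
    by (auto simp: uph_def intro: proves_weaken split: nat.split)
  have uptm: "\<forall>n < length (map (sub_fm shift) \<Gamma>).
      map (sub_fm shift) \<Delta> \<turnstile> uptm s n \<Colon> map (sub_fm shift) \<Gamma> ! n"
    if "\<forall>n < length \<Gamma>. \<Delta> \<turnstile> s n \<Colon> \<Gamma> ! n"
    for s and \<Gamma> \<Delta> :: "('a, 'b) fm list"
    using that by (auto simp: uptm_def intro: proves_tsub)
  show ?thesis using assms
  proof (induction arbitrary: s \<Delta> rule: proves.induct)
    case (OrE \<Gamma> p A B q C r')
    then show ?case
      using OrE.IH(1)[OF OrE.prems] OrE.IH(2,3)[OF up[OF OrE.prems]] by (auto intro: proves.OrE)
  next
    case (ImpI A \<Gamma> p B)
    then show ?case using ImpI.IH[OF up[OF ImpI.prems]] by (auto intro: proves.ImpI)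
  next
    case (AllI \<Gamma> p A)
    then show ?case using AllI.IH[OF uptm[OF AllI.prems]] by (auto intro: proves.AllI)
  next
    case (ExE \<Gamma> p A q C)
    from ExE.IH(2)[OF up[OF uptm[OF ExE.prems]]] ExE.IH(1)[OF ExE.prems]
    show ?case by (simp, intro proves.ExE) auto
  next
    case (ImpE \<Gamma> p A B q)
    show ?case
      using proves.ImpE[OF ImpE.IH(1)[OF ImpE.prems] ImpE.IH(2)[OF ImpE.prems]] by simp
  qed (auto intro: proves.intros)
qed

lemma proves_subst0: "A # \<Gamma> \<turnstile> p \<Colon> B \<Longrightarrow> \<Gamma> \<turnstile> q \<Colon> A \<Longrightarrow> \<Gamma> \<turnstile> subst0 q p \<Colon> B"
  unfolding subst0_def
  by (rule proves_sub) (auto intro: proves.Hyp split: nat.split)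

lemma proves_inst:
  "map (sub_fm shift) \<Gamma> \<turnstile> p \<Colon> A \<Longrightarrow> \<Gamma> \<turnstile> tsub_pt (inst t) p \<Colon> sub_fm (inst t) A"
  using proves_tsub[of "map (sub_fm shift) \<Gamma>" p A "inst t"] by (simp add: comp_def)

text \<open>A typing bounds the free hypotheses by the length of its context; typability in
  \<open>[]\<close> thus plays the part of a closedness predicate.\<close>

lemma ren_pt_closed: "\<Gamma> \<turnstile> p \<Colon> A \<Longrightarrow> \<forall>n < length \<Gamma>. r n = n \<Longrightarrow> ren_pt r p = p"
  by (induction arbitrary: r rule: proves.induct)
    (simp_all add: upr_def split: nat.split)

lemma sub_pt_closed: "\<Gamma> \<turnstile> p \<Colon> A \<Longrightarrow> \<forall>n < length \<Gamma>. s n = Hyp n \<Longrightarrow> sub_pt s p = p"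
  by (induction arbitrary: s rule: proves.induct)
    (simp_all add: uph_def uptm_def split: nat.split)

lemma proves_closed: "[] \<turnstile> p \<Colon> A \<Longrightarrow> \<Gamma> \<turnstile> p \<Colon> A"
  using proves_ren[of "[]" p A id \<Gamma>] ren_pt_closed[of "[]" p A id] by simp

lemma Hyp0: "A # \<Gamma> \<turnstile> Hyp 0 \<Colon> A"
  using proves.Hyp[of 0 "A # \<Gamma>"] by simp

lemma HypS: "\<Gamma> \<turnstile> Hyp n \<Colon> A \<Longrightarrow> B # \<Gamma> \<turnstile> Hyp (Suc n) \<Colon> A"
  using proves_weaken[of \<Gamma> "Hyp n"] by simp

text \<open>The type is the one that \<open>ExE\<close> demands of its body: the eigenvariable
  itself is the witness, and instantiating \<open>sub_fm (up shift) A\<close> at it yields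
  \<open>A\<close>.\<close>

lemma TPair_Var0: "\<Gamma> \<turnstile> p \<Colon> A \<Longrightarrow> \<Gamma> \<turnstile> TPair (Var 0) p \<Colon> sub_fm shift (Exists A)"
  using proves.ExI[of \<Gamma> p "Var 0" "sub_fm (up shift) A"] by simp

lemma TApp_Var0: "\<Gamma> \<turnstile> p \<Colon> sub_fm shift (Forall A) \<Longrightarrow> \<Gamma> \<turnstile> TApp p (Var 0) \<Colon> A"
  using proves.AllE[of \<Gamma> p "sub_fm (up shift) A" "Var 0"] by simp

lemma cong_TPair_Var0:
  "\<Gamma> \<turnstile> p \<approx> q \<Colon> A \<Longrightarrow> \<Gamma> \<turnstile> TPair (Var 0) p \<approx> TPair (Var 0) q \<Colon> sub_fm shift (Exists A)"
  using cong_TPair[of \<Gamma> p q "Var 0" "sub_fm (up shift) A"] by simp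

lemma cong_TApp_Var0:
  "\<Gamma> \<turnstile> p \<approx> q \<Colon> sub_fm shift (Forall A) \<Longrightarrow> \<Gamma> \<turnstile> TApp p (Var 0) \<approx> TApp q (Var 0) \<Colon> A"
  using cong_TApp[of \<Gamma> p q "sub_fm (up shift) A" "Var 0"] by simp

subsection \<open>Normalisation\<close>

fun fst_pt :: "'f pt \<Rightarrow> 'f pt" where
  "fst_pt (MkPair p q) = p"
| "fst_pt p = Fst p"

fun snd_pt :: "'f pt \<Rightarrow> 'f pt" where
  "snd_pt (MkPair p q) = q"
| "snd_pt p = Snd p"

fun app_pt :: "'f pt \<Rightarrow> 'f pt \<Rightarrow> 'f pt" where
  "app_pt (Lam p) q = subst0 q p"
| "app_pt p q = App p q"

fun tapp_pt :: "'f pt \<Rightarrow> 'f tm \<Rightarrow> 'f pt" where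
  "tapp_pt (TLam p) t = tsub_pt (inst t) p"
| "tapp_pt p t = TApp p t"

text \<open>
  \<open>dev\<close> contracts the redexes of \<open>p\<close> from the inside out, including those that appear by contracting
  inner redexes. Redexes created by substitution may survive, so it has to be iterated; redexes for
  disjunction and existence are left alone.
\<close>

primrec dev :: "'f pt \<Rightarrow> 'f pt" where
  "dev (Hyp n) = Hyp n"
| "dev Unit = Unit"
| "dev (MkPair p q) = MkPair (dev p) (dev q)"
| "dev (Fst p) = fst_pt (dev p)"
| "dev (Snd p) = snd_pt (dev p)"
| "dev (InjL p) = InjL (dev p)"
| "dev (InjR p) = InjR (dev p)"
| "dev (Case p q r) = Case (dev p) (dev q) (dev r)"
| "dev (Lam p) = Lam (dev p)"
| "dev (App p q) = app_pt (dev p) (dev q)"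
| "dev (TLam p) = TLam (dev p)"
| "dev (TApp p t) = tapp_pt (dev p) t"
| "dev (TPair t p) = TPair t (dev p)"
| "dev (Dest p q) = Dest (dev p) (dev q)"

inductive_cases proves_MkPairE: "\<Gamma> \<turnstile> MkPair p q \<Colon> A"
inductive_cases proves_LamE: "\<Gamma> \<turnstile> Lam p \<Colon> A"
inductive_cases proves_TLamE: "\<Gamma> \<turnstile> TLam p \<Colon> A"

lemma fst_pt: "\<Gamma> \<turnstile> p \<Colon> And A B \<Longrightarrow> \<Gamma> \<turnstile> Fst p \<approx> fst_pt p \<Colon> A \<and> \<Gamma> \<turnstile> fst_pt p \<Colon> A"
  by (cases p) (auto intro: bee_refl proves.AndE1 beta_Fst elim!: proves_MkPairE)

lemma snd_pt: "\<Gamma> \<turnstile> p \<Colon> And A B \<Longrightarrow> \<Gamma> \<turnstile> Snd p \<approx> snd_pt p \<Colon> B \<and> \<Gamma> \<turnstile> snd_pt p \<Colon> B"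
  by (cases p) (auto intro: bee_refl proves.AndE2 beta_Snd elim!: proves_MkPairE)

lemma app_pt:
  "\<Gamma> \<turnstile> p \<Colon> Imp A B \<Longrightarrow> \<Gamma> \<turnstile> q \<Colon> A \<Longrightarrow>
    \<Gamma> \<turnstile> App p q \<approx> app_pt p q \<Colon> B \<and> \<Gamma> \<turnstile> app_pt p q \<Colon> B"
  by (cases p)
    (auto intro: bee_refl proves.ImpE beta_Imp proves_subst0 elim!: proves_LamE)

lemma tapp_pt:
  "\<Gamma> \<turnstile> p \<Colon> Forall A \<Longrightarrow> \<Gamma> \<turnstile> TApp p t \<approx> tapp_pt p t \<Colon> sub_fm (inst t) A \<and>
    \<Gamma> \<turnstile> tapp_pt p t \<Colon> sub_fm (inst t) A"
  by (cases p)
    (auto intro: bee_refl proves.AllE beta_Forall proves_inst elim!: proves_TLamE)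

text \<open>The typing of \<open>dev p\<close> is carried along because the contraction lemmas are
  applied to the evaluated subterms, whose type they have to know.\<close>

lemma bee_dev: "\<Gamma> \<turnstile> p \<Colon> A \<Longrightarrow> \<Gamma> \<turnstile> p \<approx> dev p \<Colon> A \<and> \<Gamma> \<turnstile> dev p \<Colon> A"
proof (induction rule: proves.induct)
  case (AndE1 \<Gamma> p A B)
  then show ?case using fst_pt[of \<Gamma> "dev p"] by (auto intro: bee_trans cong_Fst)
next
  case (AndE2 \<Gamma> p A B)
  then show ?case using snd_pt[of \<Gamma> "dev p"] by (auto intro: bee_trans cong_Snd)
next
  case (ImpE \<Gamma> p A B q)
  then show ?case using app_pt[of \<Gamma> "dev p" A B "dev q"] by (auto intro: bee_trans cong_App)
next
  case (AllE \<Gamma> p A t)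
  then show ?case using tapp_pt[of \<Gamma> "dev p" A t] by (auto intro: bee_trans cong_TApp)
qed (auto intro: bee_refl cong_Pair cong_Inl cong_Inr cong_Case cong_Lam cong_TLam cong_TPair
    cong_Dest proves.intros)

text \<open>Turns an equation into a computation. Three rounds of \<open>dev\<close> are enough for
  the terms to which this is applied below.\<close>

lemma bee_by_dev:
  assumes "\<Gamma> \<turnstile> p \<Colon> A" "\<Gamma> \<turnstile> q \<Colon> A" "dev (dev (dev p)) = dev (dev (dev q))"
  shows "\<Gamma> \<turnstile> p \<approx> q \<Colon> A"
proof -
  have "\<Gamma> \<turnstile> p \<approx> dev (dev (dev p)) \<Colon> A" if "\<Gamma> \<turnstile> p \<Colon> A" for p
    using that bee_dev by (meson bee_trans)
  from this[OF assms(1)] this[OF assms(2)] show ?thesis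
    unfolding assms(3) by (rule bee_trans[OF _ bee_sym])
qed

text \<open>Takes the typing of the whole abstraction, which is what \<open>proves_closed\<close>
  delivers for a closed term.\<close>

lemma beta_Imp': "\<Gamma> \<turnstile> Lam p \<Colon> Imp A B \<Longrightarrow> \<Gamma> \<turnstile> q \<Colon> A \<Longrightarrow> \<Gamma> \<turnstile> App (Lam p) q \<approx> subst0 q p \<Colon> B"
  using app_pt[of \<Gamma> "Lam p" A B q] by simp

lemma beta_Forall_Var0:
  assumes "\<Gamma> \<turnstile> TLam p \<Colon> sub_fm shift (Forall A)"
  shows "\<Gamma> \<turnstile> TApp (TLam p) (Var 0) \<approx> tsub_pt (inst (Var 0)) p \<Colon> A"
  using assms tapp_pt[of \<Gamma> "TLam p" "sub_fm (up shift) A" "Var 0"] by simp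

subsection \<open>Extensionality\<close>

lemma ext_Top: "\<Gamma> \<turnstile> p \<Colon> Top \<Longrightarrow> \<Gamma> \<turnstile> q \<Colon> Top \<Longrightarrow> \<Gamma> \<turnstile> p \<approx> q \<Colon> Top"
  by (blast intro: eta_Top bee_sym bee_trans)

text \<open>Both sides are eta-expanded, and the expansions agree by congruence;
  \<open>ext_Imp\<close> and \<open>ext_Forall\<close> follow the same argument.\<close>

lemma ext_And:
  assumes "\<Gamma> \<turnstile> p \<Colon> And A B" "\<Gamma> \<turnstile> q \<Colon> And A B"
    "\<Gamma> \<turnstile> Fst p \<approx> Fst q \<Colon> A" "\<Gamma> \<turnstile> Snd p \<approx> Snd q \<Colon> B"
  shows "\<Gamma> \<turnstile> p \<approx> q \<Colon> And A B"
  using assms by (meson bee_sym bee_trans cong_Pair eta_And)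

lemma ext_Imp:
  assumes "\<Gamma> \<turnstile> p \<Colon> Imp A B" "\<Gamma> \<turnstile> q \<Colon> Imp A B"
    "A # \<Gamma> \<turnstile> App (ren_pt Suc p) (Hyp 0) \<approx> App (ren_pt Suc q) (Hyp 0) \<Colon> B"
  shows "\<Gamma> \<turnstile> p \<approx> q \<Colon> Imp A B"
  using assms by (meson bee_sym bee_trans cong_Lam eta_Imp)

lemma ext_Forall:
  assumes "\<Gamma> \<turnstile> p \<Colon> Forall A" "\<Gamma> \<turnstile> q \<Colon> Forall A"
    "map (sub_fm shift) \<Gamma> \<turnstile> TApp (tsub_pt shift p) (Var 0) \<approx> TApp (tsub_pt shift q) (Var 0) \<Colon> A"
  shows "\<Gamma> \<turnstile> p \<approx> q \<Colon> Forall A"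
  using assms by (meson bee_sym bee_trans cong_TLam eta_Forall)

lemma proves_App_Hyp0: "\<Gamma> \<turnstile> p \<Colon> Imp A B \<Longrightarrow> A # \<Gamma> \<turnstile> App (ren_pt Suc p) (Hyp 0) \<Colon> B"
  by (rule proves.ImpE[OF proves_weaken Hyp0])

text \<open>
  The primed rules pass typings of both sides on to the remaining equations, so that after
  decomposing an equation \<open>bee_by_dev\<close> finds its typing premises among the assumptions.
\<close>

lemma ext_And':
  assumes "\<Gamma> \<turnstile> p \<Colon> And A B" "\<Gamma> \<turnstile> q \<Colon> And A B"
    "\<Gamma> \<turnstile> Fst p \<Colon> A \<Longrightarrow> \<Gamma> \<turnstile> Fst q \<Colon> A \<Longrightarrow> \<Gamma> \<turnstile> Fst p \<approx> Fst q \<Colon> A"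
    "\<Gamma> \<turnstile> Snd p \<Colon> B \<Longrightarrow> \<Gamma> \<turnstile> Snd q \<Colon> B \<Longrightarrow> \<Gamma> \<turnstile> Snd p \<approx> Snd q \<Colon> B"
  shows "\<Gamma> \<turnstile> p \<approx> q \<Colon> And A B"
  using ext_And[OF assms(1,2)] assms(1,2)[THEN proves.AndE1] assms(1,2)[THEN proves.AndE2] assms(3,4)
  by simp

lemma ext_Imp':
  assumes "\<Gamma> \<turnstile> p \<Colon> Imp A B" "\<Gamma> \<turnstile> q \<Colon> Imp A B"
    "A # \<Gamma> \<turnstile> App (ren_pt Suc p) (Hyp 0) \<Colon> B \<Longrightarrow> A # \<Gamma> \<turnstile> App (ren_pt Suc q) (Hyp 0) \<Colon> B \<Longrightarrow>
      A # \<Gamma> \<turnstile> App (ren_pt Suc p) (Hyp 0) \<approx> App (ren_pt Suc q) (Hyp 0) \<Colon> B"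
  shows "\<Gamma> \<turnstile> p \<approx> q \<Colon> Imp A B"
  using ext_Imp[OF assms(1,2)] assms(1,2)[THEN proves_App_Hyp0] assms(3) by simp

lemma ext_Forall':
  fixes \<Gamma> p q A
  defines "\<Delta> \<equiv> map (sub_fm shift) \<Gamma>"
    and "p' \<equiv> TApp (tsub_pt shift p) (Var 0)" and "q' \<equiv> TApp (tsub_pt shift q) (Var 0)"
  assumes "\<Gamma> \<turnstile> p \<Colon> Forall A" "\<Gamma> \<turnstile> q \<Colon> Forall A"
    "\<Delta> \<turnstile> p' \<Colon> A \<Longrightarrow> \<Delta> \<turnstile> q' \<Colon> A \<Longrightarrow> \<Delta> \<turnstile> p' \<approx> q' \<Colon> A"
  shows "\<Gamma> \<turnstile> p \<approx> q \<Colon> Forall A"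
  using ext_Forall[OF assms(4,5)] assms(4,5)[THEN proves_tsub, THEN TApp_Var0] assms(6)
  by (simp add: \<Delta>_def p'_def q'_def)

subsection \<open>Isomorphism in all contexts\<close>

text \<open>
  Quantifying over the context makes weakening of \<open>\<approx>\<close> unnecessary.
\<close>

definition retraction :: "'f pt \<Rightarrow> 'f pt \<Rightarrow> ('f, 'p) fm \<Rightarrow> bool" where
  "retraction \<psi> \<phi> A \<longleftrightarrow> (\<forall>\<Gamma>. A # \<Gamma> \<turnstile> App \<psi> (App \<phi> (Hyp 0)) \<approx> Hyp 0 \<Colon> A)"

definition iso :: "('f, 'p) fm \<Rightarrow> ('f, 'p) fm \<Rightarrow> bool" where
  "iso A B \<longleftrightarrow> (\<exists>\<phi> \<psi>. [] \<turnstile> \<phi> \<Colon> Imp A B \<and> [] \<turnstile> \<psi> \<Colon> Imp B A \<and>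
     retraction \<psi> \<phi> A \<and> retraction \<phi> \<psi> B)"

lemma sub_pt_closed_Nil: "[] \<turnstile> p \<Colon> A \<Longrightarrow> sub_pt s p = p"
  by (rule sub_pt_closed) auto

lemma ren_pt_closed_Nil: "[] \<turnstile> p \<Colon> A \<Longrightarrow> ren_pt r p = p"
  by (rule ren_pt_closed) auto

text \<open>The retraction equations in the empty context, put under \<open>Lam\<close>, are the
  required ones, since weakening leaves the closed terms \<phi> and \<psi> unchanged.\<close>

lemma iso_imp_isomorphic: "iso A B \<Longrightarrow> A \<cong> B"
proof -
  assume "iso A B"
  then obtain \<phi> \<psi> where t: "[] \<turnstile> \<phi> \<Colon> Imp A B" "[] \<turnstile> \<psi> \<Colon> Imp B A"
    and "retraction \<psi> \<phi> A" "retraction \<phi> \<psi> B"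
    unfolding iso_def by blast
  then have "[] \<turnstile> Lam (App \<psi> (App \<phi> (Hyp 0))) \<approx> Lam (Hyp 0) \<Colon> Imp A A"
    "[] \<turnstile> Lam (App \<phi> (App \<psi> (Hyp 0))) \<approx> Lam (Hyp 0) \<Colon> Imp B B"
    unfolding retraction_def by (simp_all add: cong_Lam)
  with t show ?thesis
    unfolding isomorphic_def using ren_pt_closed_Nil[OF t(1)] ren_pt_closed_Nil[OF t(2)] by metis
qed

lemma iso_sym: "iso A B \<Longrightarrow> iso B A"
  unfolding iso_def by blast

text \<open>Replaces hypothesis 0 by an arbitrary term: the equation is abstracted, both
  abstractions are applied to \<open>u\<close>, and both redexes are contracted. Being closed,
  \<phi> and \<psi> survive the substitution.\<close>

lemma retractionD:
  assumes "retraction \<psi> \<phi> A" "[] \<turnstile> \<phi> \<Colon> Imp A B" "[] \<turnstile> \<psi> \<Colon> Imp B A" "\<Gamma> \<turnstile> u \<Colon> A"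
  shows "\<Gamma> \<turnstile> App \<psi> (App \<phi> u) \<approx> u \<Colon> A"
proof -
  let ?e = "App \<psi> (App \<phi> (Hyp 0))"
  have e: "A # \<Gamma> \<turnstile> ?e \<approx> Hyp 0 \<Colon> A" using assms(1) by (simp add: retraction_def)
  have t: "A # \<Gamma> \<turnstile> ?e \<Colon> A"
    by (rule proves.ImpE[OF proves_closed[OF assms(3)] proves.ImpE[OF proves_closed[OF assms(2)] Hyp0]])
  have 1: "\<Gamma> \<turnstile> App (Lam ?e) u \<approx> App (Lam (Hyp 0)) u \<Colon> A"
    by (rule cong_App[OF cong_Lam[OF e] bee_refl[OF assms(4)]])
  have 2: "\<Gamma> \<turnstile> App (Lam ?e) u \<approx> App \<psi> (App \<phi> u) \<Colon> A"
    using beta_Imp[OF t assms(4)] assms(2,3) by (simp add: subst0_def sub_pt_closed_Nil)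
  have 3: "\<Gamma> \<turnstile> App (Lam (Hyp 0)) u \<approx> u \<Colon> A"
    using beta_Imp[OF Hyp0 assms(4)] by (simp add: subst0_def)
  show ?thesis by (rule bee_trans[OF bee_sym[OF 2] bee_trans[OF 1 3]])
qed

text \<open>In a round trip from A through C the inner pair of maps cancels at B, then the outer
  pair at A.\<close>

lemma iso_trans:
  assumes "iso A B" "iso B C"
  shows "iso A C"
proof -
  define comp where "comp \<phi> \<psi> = Lam (App \<psi> (App \<phi> (Hyp 0)))" for \<phi> \<psi> :: "'a pt"
  have ty: "[] \<turnstile> comp \<phi> \<psi> \<Colon> Imp A C" if "[] \<turnstile> \<phi> \<Colon> Imp A B" "[] \<turnstile> \<psi> \<Colon> Imp B C"
    for \<phi> \<psi> and A B C :: "('a, 'b) fm"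
    using that[THEN proves_closed] unfolding comp_def by (blast intro: proves.ImpI proves.ImpE Hyp0)
  have app: "\<Gamma> \<turnstile> App (comp \<phi> \<psi>) u \<approx> App \<psi> (App \<phi> u) \<Colon> C"
    if "[] \<turnstile> \<phi> \<Colon> Imp A B" "[] \<turnstile> \<psi> \<Colon> Imp B C" "\<Gamma> \<turnstile> u \<Colon> A"
    for \<phi> \<psi> \<Gamma> u and A B C :: "('a, 'b) fm"
    using beta_Imp'[OF proves_closed[OF ty[OF that(1,2), unfolded comp_def]] that(3)] that
    by (simp add: subst0_def sub_pt_closed_Nil comp_def)
  \<comment> \<open>Stated for arbitrary terms and formulas, so that exchanging the roles of the two
    directions also yields the other composite. The congruence proofs repeat this device.\<close>
  have retr: "retraction (comp \<psi>' \<phi>') (comp \<phi> \<psi>) A"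
    if t: "[] \<turnstile> \<phi> \<Colon> Imp A B" "[] \<turnstile> \<psi> \<Colon> Imp B C" "[] \<turnstile> \<phi>' \<Colon> Imp B A" "[] \<turnstile> \<psi>' \<Colon> Imp C B"
      and r: "retraction \<phi>' \<phi> A" "retraction \<psi>' \<psi> B"
    for \<phi> \<psi> \<phi>' \<psi>' and A B C :: "('a, 'b) fm"
    unfolding retraction_def
  proof
    fix \<Gamma>
    have u: "A # \<Gamma> \<turnstile> Hyp 0 \<Colon> A" by (rule Hyp0)
    have t': "A # \<Gamma> \<turnstile> App \<phi> (Hyp 0) \<Colon> B"
      using proves_closed[OF t(1)] u by (blast intro: proves.ImpE)
    have c: "\<Delta> \<turnstile> comp \<phi> \<psi> \<Colon> Imp A C" "\<Delta> \<turnstile> comp \<psi>' \<phi>' \<Colon> Imp C A" "\<Delta> \<turnstile> \<phi>' \<Colon> Imp B A" for \<Delta>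
      by (rule proves_closed[OF ty[OF t(1,2)]] proves_closed[OF ty[OF t(4,3)]] proves_closed[OF t(3)])+
    have "A # \<Gamma> \<turnstile> App (comp \<psi>' \<phi>') (App (comp \<phi> \<psi>) (Hyp 0))
        \<approx> App (comp \<psi>' \<phi>') (App \<psi> (App \<phi> (Hyp 0))) \<Colon> A"
      by (rule cong_App[OF bee_refl[OF c(2)] app[OF t(1,2) u]])
    moreover have "A # \<Gamma> \<turnstile> App (comp \<psi>' \<phi>') (App \<psi> (App \<phi> (Hyp 0)))
        \<approx> App \<phi>' (App \<psi>' (App \<psi> (App \<phi> (Hyp 0)))) \<Colon> A"
      by (rule app[OF t(4,3) proves.ImpE[OF proves_closed[OF t(2)] t']])
    moreover have "A # \<Gamma> \<turnstile> App \<phi>' (App \<psi>' (App \<psi> (App \<phi> (Hyp 0)))) \<approx> App \<phi>' (App \<phi> (Hyp 0)) \<Colon> A"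
      by (rule cong_App[OF bee_refl[OF c(3)] retractionD[OF r(2) t(2,4) t']])
    moreover have "A # \<Gamma> \<turnstile> App \<phi>' (App \<phi> (Hyp 0)) \<approx> Hyp 0 \<Colon> A"
      by (rule retractionD[OF r(1) t(1,3) u])
    ultimately show "A # \<Gamma> \<turnstile> App (comp \<psi>' \<phi>') (App (comp \<phi> \<psi>) (Hyp 0)) \<approx> Hyp 0 \<Colon> A"
      by (blast intro: bee_trans)
  qed
  from assms obtain \<phi> \<psi> \<phi>' \<psi>' where
    "[] \<turnstile> \<phi> \<Colon> Imp A B" "[] \<turnstile> \<psi> \<Colon> Imp B C" "[] \<turnstile> \<phi>' \<Colon> Imp B A" "[] \<turnstile> \<psi>' \<Colon> Imp C B"
    "retraction \<phi>' \<phi> A" "retraction \<psi>' \<psi> B" "retraction \<phi> \<phi>' B" "retraction \<psi> \<psi>' C"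
    unfolding iso_def by blast
  then show ?thesis unfolding iso_def using ty retr by blast
qed

declare iso_trans [trans]

subsection \<open>Congruence\<close>

text \<open>\<open>m\<close> is the action of the product on a pair of maps. The round trip cancels
  in each component, and surjective pairing reassembles the argument.\<close>

lemma iso_And:
  assumes "iso A A'" "iso B B'"
  shows "iso (And A B) (And A' B')"
proof -
  define m where "m \<phi> \<chi> = Lam (MkPair (App \<phi> (Fst (Hyp 0))) (App \<chi> (Snd (Hyp 0))))"
    for \<phi> \<chi> :: "'a pt"
  have ty: "[] \<turnstile> m \<phi> \<chi> \<Colon> Imp (And A B) (And A' B')" if "[] \<turnstile> \<phi> \<Colon> Imp A A'" "[] \<turnstile> \<chi> \<Colon> Imp B B'"
    for \<phi> \<chi> and A B A' B' :: "('a, 'b) fm"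
    using that[THEN proves_closed] unfolding m_def
    by (blast intro: proves.ImpI proves.ImpE proves.AndI proves.AndE1 proves.AndE2 Hyp0)
  have app: "\<Gamma> \<turnstile> App (m \<phi> \<chi>) u \<approx> MkPair (App \<phi> (Fst u)) (App \<chi> (Snd u)) \<Colon> And A' B'"
    if "[] \<turnstile> \<phi> \<Colon> Imp A A'" "[] \<turnstile> \<chi> \<Colon> Imp B B'" "\<Gamma> \<turnstile> u \<Colon> And A B"
    for \<phi> \<chi> \<Gamma> u and A B A' B' :: "('a, 'b) fm"
    using beta_Imp'[OF proves_closed[OF ty[OF that(1,2), unfolded m_def]] that(3)] that
    by (simp add: subst0_def sub_pt_closed_Nil m_def)
  have retr: "retraction (m \<psi> \<omega>) (m \<phi> \<chi>) (And A B)"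
    if t: "[] \<turnstile> \<phi> \<Colon> Imp A A'" "[] \<turnstile> \<chi> \<Colon> Imp B B'" "[] \<turnstile> \<psi> \<Colon> Imp A' A" "[] \<turnstile> \<omega> \<Colon> Imp B' B"
      and r: "retraction \<psi> \<phi> A" "retraction \<omega> \<chi> B"
    for \<phi> \<chi> \<psi> \<omega> and A B A' B' :: "('a, 'b) fm"
    unfolding retraction_def
  proof
    fix \<Gamma>
    let ?G = "And A B # \<Gamma>" and ?u = "Hyp 0 :: 'a pt"
    let ?v = "App (m \<phi> \<chi>) ?u"
    have u: "?G \<turnstile> ?u \<Colon> And A B" by (rule Hyp0)
    note u1 = proves.AndE1[OF u] and u2 = proves.AndE2[OF u]
    have v: "?G \<turnstile> ?v \<Colon> And A' B'" by (rule proves.ImpE[OF proves_closed[OF ty[OF t(1,2)]] u])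
    have v1: "?G \<turnstile> App \<phi> (Fst ?u) \<Colon> A'" by (rule proves.ImpE[OF proves_closed[OF t(1)] u1])
    have v2: "?G \<turnstile> App \<chi> (Snd ?u) \<Colon> B'" by (rule proves.ImpE[OF proves_closed[OF t(2)] u2])
    have "?G \<turnstile> Fst ?v \<approx> App \<phi> (Fst ?u) \<Colon> A'"
      by (rule bee_trans[OF cong_Fst[OF app[OF t(1,2) u]] beta_Fst[OF v1 v2]])
    then have a: "?G \<turnstile> App \<psi> (Fst ?v) \<approx> Fst ?u \<Colon> A"
      using cong_App[OF bee_refl[OF proves_closed[OF t(3)]]] retractionD[OF r(1) t(1,3) u1]
      by (blast intro: bee_trans)
    have "?G \<turnstile> Snd ?v \<approx> App \<chi> (Snd ?u) \<Colon> B'"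
      by (rule bee_trans[OF cong_Snd[OF app[OF t(1,2) u]] beta_Snd[OF v1 v2]])
    then have b: "?G \<turnstile> App \<omega> (Snd ?v) \<approx> Snd ?u \<Colon> B"
      using cong_App[OF bee_refl[OF proves_closed[OF t(4)]]] retractionD[OF r(2) t(2,4) u2]
      by (blast intro: bee_trans)
    show "?G \<turnstile> App (m \<psi> \<omega>) ?v \<approx> ?u \<Colon> And A B"
      using app[OF t(3,4) v] cong_Pair[OF a b] bee_sym[OF eta_And[OF u]] by (blast intro: bee_trans)
  qed
  from assms obtain \<phi> \<chi> \<psi> \<omega> where
    "[] \<turnstile> \<phi> \<Colon> Imp A A'" "[] \<turnstile> \<chi> \<Colon> Imp B B'" "[] \<turnstile> \<psi> \<Colon> Imp A' A" "[] \<turnstile> \<omega> \<Colon> Imp B' B"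
    "retraction \<psi> \<phi> A" "retraction \<omega> \<chi> B" "retraction \<phi> \<psi> A'" "retraction \<chi> \<omega> B'"
    unfolding iso_def by blast
  then show ?thesis unfolding iso_def using ty retr by blast
qed

lemma iso_Imp:
  assumes "iso A A'" "iso B B'"
  shows "iso (Imp A B) (Imp A' B')"
proof -
  \<comment> \<open>Implication is contravariant in its premise: \<open>m\<close> sends f to the
    composite of \<psi>, f and \<chi>, where \<psi> runs from the new premise back to the old
    one.\<close>
  define m where "m \<psi> \<chi> = Lam (Lam (App \<chi> (App (Hyp (Suc 0)) (App \<psi> (Hyp 0)))))"
    for \<psi> \<chi> :: "'a pt"
  have ty: "[] \<turnstile> m \<psi> \<chi> \<Colon> Imp (Imp A B) (Imp A' B')" if "[] \<turnstile> \<psi> \<Colon> Imp A' A" "[] \<turnstile> \<chi> \<Colon> Imp B B'"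
    for \<psi> \<chi> and A B A' B' :: "('a, 'b) fm"
    using that[THEN proves_closed] unfolding m_def
    by (blast intro: proves.ImpI proves.ImpE Hyp0 HypS)
  \<comment> \<open>A second argument is supplied because \<open>App (m \<psi> \<chi>) u\<close>
    evaluates to an abstraction over a weakened \<open>u\<close>; contracting it with
    \<open>a\<close> removes the weakening.\<close>
  have app: "\<Gamma> \<turnstile> App (App (m \<psi> \<chi>) u) a \<approx> App \<chi> (App u (App \<psi> a)) \<Colon> B'"
    if t: "[] \<turnstile> \<psi> \<Colon> Imp A' A" "[] \<turnstile> \<chi> \<Colon> Imp B B'" and u: "\<Gamma> \<turnstile> u \<Colon> Imp A B" and a: "\<Gamma> \<turnstile> a \<Colon> A'"
    for \<psi> \<chi> \<Gamma> u a and A B A' B' :: "('a, 'b) fm"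
  proof -
    let ?w = "Lam (App \<chi> (App (ren_pt Suc u) (App \<psi> (Hyp 0))))"
    have "\<Gamma> \<turnstile> App (m \<psi> \<chi>) u \<approx> ?w \<Colon> Imp A' B' \<and> \<Gamma> \<turnstile> ?w \<Colon> Imp A' B'"
      using app_pt[OF proves_closed[OF ty[OF t]] u] t
      by (simp add: m_def subst0_def sub_pt_closed_Nil)
    then have 1: "\<Gamma> \<turnstile> App (App (m \<psi> \<chi>) u) a \<approx> App ?w a \<Colon> B'" and w: "\<Gamma> \<turnstile> ?w \<Colon> Imp A' B'"
      using a by (blast intro: cong_App bee_refl)+
    have "\<Gamma> \<turnstile> App ?w a \<approx> App \<chi> (App u (App \<psi> a)) \<Colon> B'"
      using beta_Imp'[OF w a] t by (simp add: subst0_def sub_pt_closed_Nil)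
    with 1 show ?thesis by (rule bee_trans)
  qed
  have retr: "retraction (m \<phi> \<omega>) (m \<psi> \<chi>) (Imp A B)"
    if t: "[] \<turnstile> \<phi> \<Colon> Imp A A'" "[] \<turnstile> \<chi> \<Colon> Imp B B'" "[] \<turnstile> \<psi> \<Colon> Imp A' A" "[] \<turnstile> \<omega> \<Colon> Imp B' B"
      and r: "retraction \<psi> \<phi> A" "retraction \<omega> \<chi> B"
    for \<phi> \<chi> \<psi> \<omega> and A B A' B' :: "('a, 'b) fm"
    unfolding retraction_def
  proof
    fix \<Gamma>
    let ?D = "Imp A B # \<Gamma>"
    let ?G = "A # ?D"
    let ?f = "Hyp (Suc 0) :: 'a pt" and ?a = "Hyp 0 :: 'a pt"
    let ?v = "App (m \<psi> \<chi>) ?f"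
    have f: "?G \<turnstile> ?f \<Colon> Imp A B" by (intro Hyp0 HypS)
    have a: "?G \<turnstile> ?a \<Colon> A" by (rule Hyp0)
    have a': "?G \<turnstile> App \<phi> ?a \<Colon> A'" by (rule proves.ImpE[OF proves_closed[OF t(1)] a])
    have v: "?G \<turnstile> ?v \<Colon> Imp A' B'" by (rule proves.ImpE[OF proves_closed[OF ty[OF t(3,2)]] f])
    have "?G \<turnstile> App (App (m \<phi> \<omega>) ?v) ?a \<approx> App \<omega> (App ?v (App \<phi> ?a)) \<Colon> B"
      by (rule app[OF t(1,4) v a])
    moreover have "?G \<turnstile> App \<omega> (App ?v (App \<phi> ?a)) \<approx> App \<omega> (App \<chi> (App ?f (App \<psi> (App \<phi> ?a)))) \<Colon> B"
      by (rule cong_App[OF bee_refl[OF proves_closed[OF t(4)]] app[OF t(3,2) f a']])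
    moreover have "?G \<turnstile> App \<omega> (App \<chi> (App ?f (App \<psi> (App \<phi> ?a)))) \<approx> App \<omega> (App \<chi> (App ?f ?a)) \<Colon> B"
      by (rule cong_App[OF bee_refl[OF proves_closed[OF t(4)]]
            cong_App[OF bee_refl[OF proves_closed[OF t(2)]]
              cong_App[OF bee_refl[OF f] retractionD[OF r(1) t(1,3) a]]]])
    moreover have "?G \<turnstile> App \<omega> (App \<chi> (App ?f ?a)) \<approx> App ?f ?a \<Colon> B"
      by (rule retractionD[OF r(2) t(2,4) proves.ImpE[OF f a]])
    ultimately have *: "?G \<turnstile> App (App (m \<phi> \<omega>) ?v) ?a \<approx> App ?f ?a \<Colon> B"
      by (blast intro: bee_trans)
    show "?D \<turnstile> App (m \<phi> \<omega>) (App (m \<psi> \<chi>) (Hyp 0)) \<approx> Hyp 0 \<Colon> Imp A B"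
    proof (rule ext_Imp)
      show "?D \<turnstile> App (m \<phi> \<omega>) (App (m \<psi> \<chi>) (Hyp 0)) \<Colon> Imp A B"
        using proves_closed[OF ty[OF t(3,2)]] proves_closed[OF ty[OF t(1,4)]]
        by (blast intro: proves.ImpE Hyp0)
    qed (use * Hyp0 in \<open>auto simp: ren_pt_closed_Nil[OF ty[OF t(3,2)]]
        ren_pt_closed_Nil[OF ty[OF t(1,4)]]\<close>)
  qed
  from assms obtain \<phi> \<chi> \<psi> \<omega> where
    "[] \<turnstile> \<phi> \<Colon> Imp A A'" "[] \<turnstile> \<chi> \<Colon> Imp B B'" "[] \<turnstile> \<psi> \<Colon> Imp A' A" "[] \<turnstile> \<omega> \<Colon> Imp B' B"
    "retraction \<psi> \<phi> A" "retraction \<omega> \<chi> B" "retraction \<phi> \<psi> A'" "retraction \<chi> \<omega> B'"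
    unfolding iso_def by blast
  then show ?thesis unfolding iso_def using ty retr by blast
qed

text \<open>By \<open>eta_Or\<close> the round trip, viewed as a function of its argument, is
  determined by its values on the two injections, where it cancels; the identity is expanded in the
  same way.\<close>

lemma iso_Or:
  assumes "iso A A'" "iso B B'"
  shows "iso (Or A B) (Or A' B')"
proof -
  define m where "m \<phi> \<chi> = Lam (Case (Hyp 0) (InjL (App \<phi> (Hyp 0))) (InjR (App \<chi> (Hyp 0))))"
    for \<phi> \<chi> :: "'a pt"
  have branches: "A # \<Gamma> \<turnstile> InjL (App \<phi> (Hyp 0)) \<Colon> Or A' B'" "B # \<Gamma> \<turnstile> InjR (App \<chi> (Hyp 0)) \<Colon> Or A' B'"
    if "[] \<turnstile> \<phi> \<Colon> Imp A A'" "[] \<turnstile> \<chi> \<Colon> Imp B B'"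
    for \<phi> \<chi> \<Gamma> and A B A' B' :: "('a, 'b) fm"
    using that[THEN proves_closed] by (blast intro: proves.ImpE proves.OrI1 proves.OrI2 Hyp0)+
  have ty: "[] \<turnstile> m \<phi> \<chi> \<Colon> Imp (Or A B) (Or A' B')" if "[] \<turnstile> \<phi> \<Colon> Imp A A'" "[] \<turnstile> \<chi> \<Colon> Imp B B'"
    for \<phi> \<chi> and A B A' B' :: "('a, 'b) fm"
    using branches[OF that] unfolding m_def by (blast intro: proves.ImpI proves.OrE Hyp0)
  have app: "\<Gamma> \<turnstile> App (m \<phi> \<chi>) u \<approx> Case u (InjL (App \<phi> (Hyp 0))) (InjR (App \<chi> (Hyp 0))) \<Colon> Or A' B'"
    if "[] \<turnstile> \<phi> \<Colon> Imp A A'" "[] \<turnstile> \<chi> \<Colon> Imp B B'" "\<Gamma> \<turnstile> u \<Colon> Or A B"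
    for \<phi> \<chi> \<Gamma> u and A B A' B' :: "('a, 'b) fm"
    using beta_Imp'[OF proves_closed[OF ty[OF that(1,2), unfolded m_def]] that(3)] that
    by (simp add: subst0_def sub_pt_closed_Nil m_def)
  have appL: "\<Gamma> \<turnstile> App (m \<phi> \<chi>) (InjL u) \<approx> InjL (App \<phi> u) \<Colon> Or A' B'"
    if t: "[] \<turnstile> \<phi> \<Colon> Imp A A'" "[] \<turnstile> \<chi> \<Colon> Imp B B'" and u: "\<Gamma> \<turnstile> u \<Colon> A"
    for \<phi> \<chi> \<Gamma> u and A B A' B' :: "('a, 'b) fm"
    using app[OF t proves.OrI1[OF u]] beta_Inl[OF u branches[OF t]] t
    by (auto simp: subst0_def sub_pt_closed_Nil intro: bee_trans)
  have appR: "\<Gamma> \<turnstile> App (m \<phi> \<chi>) (InjR u) \<approx> InjR (App \<chi> u) \<Colon> Or A' B'"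
    if t: "[] \<turnstile> \<phi> \<Colon> Imp A A'" "[] \<turnstile> \<chi> \<Colon> Imp B B'" and u: "\<Gamma> \<turnstile> u \<Colon> B"
    for \<phi> \<chi> \<Gamma> u and A B A' B' :: "('a, 'b) fm"
    using app[OF t proves.OrI2[OF u]] beta_Inr[OF u branches[OF t]] t
    by (auto simp: subst0_def sub_pt_closed_Nil intro: bee_trans)
  have retr: "retraction (m \<psi> \<omega>) (m \<phi> \<chi>) (Or A B)"
    if t: "[] \<turnstile> \<phi> \<Colon> Imp A A'" "[] \<turnstile> \<chi> \<Colon> Imp B B'" "[] \<turnstile> \<psi> \<Colon> Imp A' A" "[] \<turnstile> \<omega> \<Colon> Imp B' B"
      and r: "retraction \<psi> \<phi> A" "retraction \<omega> \<chi> B"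
    for \<phi> \<chi> \<psi> \<omega> and A B A' B' :: "('a, 'b) fm"
    unfolding retraction_def
  proof
    fix \<Gamma>
    let ?G = "Or A B # \<Gamma>" and ?u = "Hyp 0 :: 'a pt"
    let ?e = "\<lambda>u. App (m \<psi> \<omega>) (App (m \<phi> \<chi>) u)"
    note ty' = ty[OF t(1,2)] ty[OF t(3,4)]
    have u: "?G \<turnstile> ?u \<Colon> Or A B" by (rule Hyp0)
    \<comment> \<open>The extra hypothesis is the place at which \<open>eta_Or\<close>
      substitutes.\<close>
    have e: "Or A B # ?G \<turnstile> ?e (Hyp 0) \<Colon> Or A B"
      using ty'[THEN proves_closed] by (blast intro: proves.ImpE Hyp0)
    have l: "A # ?G \<turnstile> ?e (InjL ?u) \<approx> InjL ?u \<Colon> Or A B"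
    proof -
      have "A # ?G \<turnstile> ?e (InjL ?u) \<approx> App (m \<psi> \<omega>) (InjL (App \<phi> ?u)) \<Colon> Or A B"
        by (rule cong_App[OF bee_refl[OF proves_closed[OF ty'(2)]] appL[OF t(1,2) Hyp0]])
      moreover have "A # ?G \<turnstile> App (m \<psi> \<omega>) (InjL (App \<phi> ?u)) \<approx> InjL (App \<psi> (App \<phi> ?u)) \<Colon> Or A B"
        by (rule appL[OF t(3,4) proves.ImpE[OF proves_closed[OF t(1)] Hyp0]])
      moreover have "A # ?G \<turnstile> InjL (App \<psi> (App \<phi> ?u)) \<approx> InjL ?u \<Colon> Or A B"
        by (rule cong_Inl[OF retractionD[OF r(1) t(1,3) Hyp0]])
      ultimately show ?thesis by (blast intro: bee_trans)
    qed
    have r: "B # ?G \<turnstile> ?e (InjR ?u) \<approx> InjR ?u \<Colon> Or A B"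
    proof -
      have "B # ?G \<turnstile> ?e (InjR ?u) \<approx> App (m \<psi> \<omega>) (InjR (App \<chi> ?u)) \<Colon> Or A B"
        by (rule cong_App[OF bee_refl[OF proves_closed[OF ty'(2)]] appR[OF t(1,2) Hyp0]])
      moreover have "B # ?G \<turnstile> App (m \<psi> \<omega>) (InjR (App \<chi> ?u)) \<approx> InjR (App \<omega> (App \<chi> ?u)) \<Colon> Or A B"
        by (rule appR[OF t(3,4) proves.ImpE[OF proves_closed[OF t(2)] Hyp0]])
      moreover have "B # ?G \<turnstile> InjR (App \<omega> (App \<chi> ?u)) \<approx> InjR ?u \<Colon> Or A B"
        by (rule cong_Inr[OF retractionD[OF r(2) t(2,4) Hyp0]])
      ultimately show ?thesis by (blast intro: bee_trans)
    qed
    have "?G \<turnstile> ?e ?u \<approx> Case ?u (?e (InjL (Hyp 0))) (?e (InjR (Hyp 0))) \<Colon> Or A B"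
      using eta_Or[OF u e] ty' by (simp add: subst0_def replace0_def sub_pt_closed_Nil)
    moreover have "?G \<turnstile> Case ?u (?e (InjL (Hyp 0))) (?e (InjR (Hyp 0))) \<approx>
        Case ?u (InjL (Hyp 0)) (InjR (Hyp 0)) \<Colon> Or A B"
      by (rule cong_Case[OF bee_refl[OF u] l r])
    moreover have "?G \<turnstile> ?u \<approx> Case ?u (InjL (Hyp 0)) (InjR (Hyp 0)) \<Colon> Or A B"
      using eta_Or[OF u Hyp0] by (simp add: subst0_def replace0_def)
    ultimately show "?G \<turnstile> ?e ?u \<approx> ?u \<Colon> Or A B" by (blast intro: bee_sym bee_trans)
  qed
  from assms obtain \<phi> \<chi> \<psi> \<omega> where
    "[] \<turnstile> \<phi> \<Colon> Imp A A'" "[] \<turnstile> \<chi> \<Colon> Imp B B'" "[] \<turnstile> \<psi> \<Colon> Imp A' A" "[] \<turnstile> \<omega> \<Colon> Imp B' B"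
    "retraction \<psi> \<phi> A" "retraction \<omega> \<chi> B" "retraction \<phi> \<psi> A'" "retraction \<chi> \<omega> B'"
    unfolding iso_def by blast
  then show ?thesis unfolding iso_def using ty retr by blast
qed

lemma iso_Forall:
  assumes "iso A B"
  shows "iso (Forall A) (Forall B)"
proof -
  define m where "m \<phi> = Lam (TLam (App \<phi> (TApp (Hyp 0) (Var 0))))" for \<phi> :: "'a pt"
  have ty: "[] \<turnstile> m \<phi> \<Colon> Imp (Forall A) (Forall B)" if "[] \<turnstile> \<phi> \<Colon> Imp A B"
    for \<phi> and A B :: "('a, 'b) fm"
    using that unfolding m_def
    by (auto intro!: proves.ImpI proves.AllI proves.ImpE[OF proves_closed] TApp_Var0 Hyp0)
  \<comment> \<open>A term without free hypotheses may still contain free individual variables, so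
    \<open>m \<phi>\<close> is altered by the shift that extensionality for \<open>Forall\<close>
    introduces.\<close>
  have ty_shift: "[] \<turnstile> tsub_pt shift (m \<phi>) \<Colon> Imp (sub_fm shift (Forall A)) (sub_fm shift (Forall B))"
    if "[] \<turnstile> \<phi> \<Colon> Imp A B" for \<phi> and A B :: "('a, 'b) fm"
    using proves_tsub[OF ty[OF that], of shift] by simp
  have app: "\<Gamma> \<turnstile> TApp (App (tsub_pt shift (m \<phi>)) u) (Var 0) \<approx> App \<phi> (TApp u (Var 0)) \<Colon> B"
    if t: "[] \<turnstile> \<phi> \<Colon> Imp A B" and u: "\<Gamma> \<turnstile> u \<Colon> sub_fm shift (Forall A)"
    for \<phi> \<Gamma> u and A B :: "('a, 'b) fm"
  proof -
    let ?w = "TLam (App (tsub_pt (up shift) \<phi>) (TApp (tsub_pt shift u) (Var 0)))"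
    have c: "sub_pt s (tsub_pt (up shift) \<phi>) = tsub_pt (up shift) \<phi>" for s
      using proves_tsub[OF t, of "up shift"] by (simp add: sub_pt_closed_Nil)
    have "\<Gamma> \<turnstile> App (tsub_pt shift (m \<phi>)) u \<approx> ?w \<Colon> sub_fm shift (Forall B) \<and>
        \<Gamma> \<turnstile> ?w \<Colon> sub_fm shift (Forall B)"
      using app_pt[OF proves_closed[OF ty_shift[OF t]] u]
      by (simp add: m_def subst0_def uptm_def c)
    then have 1: "\<Gamma> \<turnstile> TApp (App (tsub_pt shift (m \<phi>)) u) (Var 0) \<approx> TApp ?w (Var 0) \<Colon> B"
      and w: "\<Gamma> \<turnstile> ?w \<Colon> sub_fm shift (Forall B)"
      by (blast intro: cong_TApp_Var0)+
    \<comment> \<open>Instantiation at \<open>Var 0\<close> undoes both \<open>up shift\<close> on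
      \<phi> and \<open>shift\<close> on \<open>u\<close>.\<close>
    show ?thesis using bee_trans[OF 1 beta_Forall_Var0[OF w]] by simp
  qed
  have retr: "retraction (m \<psi>) (m \<phi>) (Forall A)"
    if t: "[] \<turnstile> \<phi> \<Colon> Imp A B" "[] \<turnstile> \<psi> \<Colon> Imp B A" and r: "retraction \<psi> \<phi> A"
    for \<phi> \<psi> and A B :: "('a, 'b) fm"
    unfolding retraction_def
  proof
    fix \<Gamma>
    let ?G = "Forall A # \<Gamma>" and ?u = "Hyp 0 :: 'a pt"
    let ?S = "sub_fm shift (Forall A) # map (sub_fm shift) \<Gamma>"
    let ?v = "App (tsub_pt shift (m \<phi>)) ?u"
    have u: "?S \<turnstile> ?u \<Colon> sub_fm shift (Forall A)" by (rule Hyp0)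
    have v: "?S \<turnstile> ?v \<Colon> sub_fm shift (Forall B)"
      by (rule proves.ImpE[OF proves_closed[OF ty_shift[OF t(1)]] u])
    have "?S \<turnstile> TApp (App (tsub_pt shift (m \<psi>)) ?v) (Var 0) \<approx> App \<psi> (TApp ?v (Var 0)) \<Colon> A"
      by (rule app[OF t(2) v])
    moreover have "?S \<turnstile> App \<psi> (TApp ?v (Var 0)) \<approx> App \<psi> (App \<phi> (TApp ?u (Var 0))) \<Colon> A"
      by (rule cong_App[OF bee_refl[OF proves_closed[OF t(2)]] app[OF t(1) u]])
    moreover have "?S \<turnstile> App \<psi> (App \<phi> (TApp ?u (Var 0))) \<approx> TApp ?u (Var 0) \<Colon> A"
      by (rule retractionD[OF r t TApp_Var0[OF u]])
    ultimately have *: "?S \<turnstile> TApp (App (tsub_pt shift (m \<psi>)) ?v) (Var 0) \<approx> TApp ?u (Var 0) \<Colon> A"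
      by (blast intro: bee_trans)
    show "?G \<turnstile> App (m \<psi>) (App (m \<phi>) ?u) \<approx> ?u \<Colon> Forall A"
    proof (rule ext_Forall)
      show "?G \<turnstile> App (m \<psi>) (App (m \<phi>) ?u) \<Colon> Forall A"
        using t[THEN ty, THEN proves_closed] by (blast intro: proves.ImpE Hyp0)
    qed (use * Hyp0 in auto)
  qed
  from assms obtain \<phi> \<psi> where
    "[] \<turnstile> \<phi> \<Colon> Imp A B" "[] \<turnstile> \<psi> \<Colon> Imp B A" "retraction \<psi> \<phi> A" "retraction \<phi> \<psi> B"
    unfolding iso_def by blast
  then show ?thesis unfolding iso_def using ty retr by blast
qed

text \<open>Parallel to disjunction: \<open>eta_Exists\<close> reduces the round trip to its value
  on the generic pair \<open>TPair (Var 0) (Hyp 0)\<close>, taken in the shifted context, so the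
  maps appear shifted there.\<close>

lemma iso_Exists:
  assumes "iso A B"
  shows "iso (Exists A) (Exists B)"
proof -
  define m where "m \<phi> = Lam (Dest (Hyp 0) (TPair (Var 0) (App \<phi> (Hyp 0))))" for \<phi> :: "'a pt"
  have body: "A # \<Gamma> \<turnstile> TPair (Var 0) (App \<phi> (Hyp 0)) \<Colon> sub_fm shift (Exists B)"
    if "[] \<turnstile> \<phi> \<Colon> Imp A B" for \<phi> \<Gamma> and A B :: "('a, 'b) fm"
    using proves_closed[OF that] by (blast intro: proves.ImpE TPair_Var0 Hyp0)
  have ty: "[] \<turnstile> m \<phi> \<Colon> Imp (Exists A) (Exists B)" if "[] \<turnstile> \<phi> \<Colon> Imp A B"
    for \<phi> and A B :: "('a, 'b) fm"
    using body[OF that] unfolding m_def by (blast intro: proves.ImpI proves.ExE Hyp0)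
  have ty_shift: "[] \<turnstile> tsub_pt shift (m \<phi>) \<Colon> Imp (sub_fm shift (Exists A)) (sub_fm shift (Exists B))"
    if "[] \<turnstile> \<phi> \<Colon> Imp A B" for \<phi> and A B :: "('a, 'b) fm"
    using proves_tsub[OF ty[OF that], of shift] by simp
  have app: "\<Gamma> \<turnstile> App (tsub_pt shift (m \<phi>)) (TPair (Var 0) u) \<approx> TPair (Var 0) (App \<phi> u)
      \<Colon> sub_fm shift (Exists B)"
    if t: "[] \<turnstile> \<phi> \<Colon> Imp A B" and u: "\<Gamma> \<turnstile> u \<Colon> A"
    for \<phi> \<Gamma> u and A B :: "('a, 'b) fm"
  proof -
    let ?q = "TPair (Var 0) (App (tsub_pt (up shift) \<phi>) (Hyp 0))"
    have t': "[] \<turnstile> tsub_pt (up shift) \<phi> \<Colon> Imp (sub_fm (up shift) A) (sub_fm (up shift) B)"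
      using proves_tsub[OF t, of "up shift"] by simp
    have "\<Gamma> \<turnstile> App (tsub_pt shift (m \<phi>)) (TPair (Var 0) u) \<approx> Dest (TPair (Var 0) u) ?q
        \<Colon> sub_fm shift (Exists B)"
      using app_pt[OF proves_closed[OF ty_shift[OF t]] TPair_Var0[OF u]]
      by (simp add: m_def subst0_def sub_pt_closed_Nil[OF t'])
    moreover have "\<Gamma> \<turnstile> Dest (TPair (Var 0) u) ?q \<approx> subst0 u (tsub_pt (inst (Var 0)) ?q)
        \<Colon> sub_fm shift (Exists B)"
      \<comment> \<open>The matrix is that of the shifted formula
        \<open>sub_fm shift (Exists A)\<close>; at \<open>Var 0\<close> it becomes \<open>A\<close>,
        the type of \<open>u\<close>.\<close>
      by (rule beta_Exists[of _ _ _ "sub_fm (up shift) A"]) (use u body[OF t'] in auto)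
    ultimately show ?thesis
      using t by (auto simp: subst0_def sub_pt_closed_Nil intro: bee_trans)
  qed
  have retr: "retraction (m \<psi>) (m \<phi>) (Exists A)"
    if t: "[] \<turnstile> \<phi> \<Colon> Imp A B" "[] \<turnstile> \<psi> \<Colon> Imp B A" and r: "retraction \<psi> \<phi> A"
    for \<phi> \<psi> and A B :: "('a, 'b) fm"
    unfolding retraction_def
  proof
    fix \<Gamma>
    let ?G = "Exists A # \<Gamma>" and ?u = "Hyp 0 :: 'a pt"
    let ?S = "A # map (sub_fm shift) ?G"
    let ?e = "\<lambda>u. App (m \<psi>) (App (m \<phi>) u)"
    let ?e' = "\<lambda>u. App (tsub_pt shift (m \<psi>)) (App (tsub_pt shift (m \<phi>)) u)"
    note ty' = t[THEN ty] and ty_shift' = t[THEN ty_shift]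
    have u: "?G \<turnstile> ?u \<Colon> Exists A" by (rule Hyp0)
    have e: "Exists A # ?G \<turnstile> ?e (Hyp 0) \<Colon> Exists A"
      using ty'[THEN proves_closed] by (blast intro: proves.ImpE Hyp0)
    have "?S \<turnstile> ?e' (TPair (Var 0) ?u) \<approx> App (tsub_pt shift (m \<psi>)) (TPair (Var 0) (App \<phi> ?u))
        \<Colon> sub_fm shift (Exists A)"
      by (rule cong_App[OF bee_refl[OF proves_closed[OF ty_shift'(2)]] app[OF t(1) Hyp0]])
    moreover have "?S \<turnstile> App (tsub_pt shift (m \<psi>)) (TPair (Var 0) (App \<phi> ?u)) \<approx>
        TPair (Var 0) (App \<psi> (App \<phi> ?u)) \<Colon> sub_fm shift (Exists A)"
      by (rule app[OF t(2) proves.ImpE[OF proves_closed[OF t(1)] Hyp0]])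
    moreover have "?S \<turnstile> TPair (Var 0) (App \<psi> (App \<phi> ?u)) \<approx> TPair (Var 0) ?u \<Colon> sub_fm shift (Exists A)"
      by (rule cong_TPair_Var0[OF retractionD[OF r t Hyp0]])
    ultimately have *: "?S \<turnstile> ?e' (TPair (Var 0) ?u) \<approx> TPair (Var 0) ?u \<Colon> sub_fm shift (Exists A)"
      by (blast intro: bee_trans)
    have "?G \<turnstile> ?e ?u \<approx> Dest ?u (?e' (TPair (Var 0) (Hyp 0))) \<Colon> Exists A"
      using eta_Exists[OF u e]
      by (simp add: subst0_def replace0_def sub_pt_closed_Nil[OF ty'(1)] sub_pt_closed_Nil[OF ty'(2)]
          sub_pt_closed_Nil[OF ty_shift'(1)] sub_pt_closed_Nil[OF ty_shift'(2)])
    moreover have "?G \<turnstile> Dest ?u (?e' (TPair (Var 0) (Hyp 0))) \<approx> Dest ?u (TPair (Var 0) (Hyp 0)) \<Colon> Exists A"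
      by (rule cong_Dest[OF bee_refl[OF u] *])
    moreover have "?G \<turnstile> ?u \<approx> Dest ?u (TPair (Var 0) (Hyp 0)) \<Colon> Exists A"
      using eta_Exists[OF u Hyp0] by (simp add: subst0_def replace0_def)
    ultimately show "?G \<turnstile> ?e ?u \<approx> ?u \<Colon> Exists A" by (blast intro: bee_sym bee_trans)
  qed
  from assms obtain \<phi> \<psi> where
    "[] \<turnstile> \<phi> \<Colon> Imp A B" "[] \<turnstile> \<psi> \<Colon> Imp B A" "retraction \<psi> \<phi> A" "retraction \<phi> \<psi> B"
    unfolding iso_def by blast
  then show ?thesis unfolding iso_def using ty retr by blast
qed

subsection \<open>High-school identities\<close>

lemma isoI:
  assumes "[] \<turnstile> \<phi> \<Colon> Imp A B" "[] \<turnstile> \<psi> \<Colon> Imp B A"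
    and "\<And>\<Gamma>. A # \<Gamma> \<turnstile> App \<psi> (App \<phi> (Hyp 0)) \<Colon> A \<Longrightarrow> A # \<Gamma> \<turnstile> Hyp 0 \<Colon> A \<Longrightarrow>
      A # \<Gamma> \<turnstile> App \<psi> (App \<phi> (Hyp 0)) \<approx> Hyp 0 \<Colon> A"
    and "\<And>\<Gamma>. B # \<Gamma> \<turnstile> App \<phi> (App \<psi> (Hyp 0)) \<Colon> B \<Longrightarrow> B # \<Gamma> \<turnstile> Hyp 0 \<Colon> B \<Longrightarrow>
      B # \<Gamma> \<turnstile> App \<phi> (App \<psi> (Hyp 0)) \<approx> Hyp 0 \<Colon> B"
  shows "iso A B"
proof -
  have t: "\<Gamma> \<turnstile> App \<psi> (App \<phi> (Hyp 0)) \<Colon> A" if "[] \<turnstile> \<phi> \<Colon> Imp A B" "[] \<turnstile> \<psi> \<Colon> Imp B A" "\<Gamma> \<turnstile> Hyp 0 \<Colon> A"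
    for \<phi> \<psi> \<Gamma> and A B :: "('a, 'b) fm"
    by (rule proves.ImpE[OF proves_closed[OF that(2)] proves.ImpE[OF proves_closed[OF that(1)] that(3)]])
  show ?thesis
    unfolding iso_def retraction_def
    using assms(1,2) assms(3)[OF t[OF assms(1,2) Hyp0] Hyp0] assms(4)[OF t[OF assms(2,1) Hyp0] Hyp0]
    by blast
qed

text \<open>Typings of the explicit witnesses are found by resolution alone, so shifted contexts and
  formulas stay unevaluated; this and the next three lemmas match them in that form.\<close>

lemma Hyp0_map: "map f (A # \<Gamma>) \<turnstile> Hyp 0 \<Colon> f A"
  using Hyp0 by simp

lemma HypS_map: "map f \<Gamma> \<turnstile> Hyp n \<Colon> A \<Longrightarrow> map f (B # \<Gamma>) \<turnstile> Hyp (Suc n) \<Colon> A"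
  using HypS by simp

lemma ImpE_sub:
  "\<Gamma> \<turnstile> p \<Colon> sub_fm s (Imp A B) \<Longrightarrow> \<Gamma> \<turnstile> q \<Colon> sub_fm s A \<Longrightarrow> \<Gamma> \<turnstile> App p q \<Colon> sub_fm s B"
  using proves.ImpE by simp

lemma AndE_sub:
  "\<Gamma> \<turnstile> p \<Colon> sub_fm s (And A B) \<Longrightarrow> \<Gamma> \<turnstile> Fst p \<Colon> sub_fm s A"
  "\<Gamma> \<turnstile> p \<Colon> sub_fm s (And A B) \<Longrightarrow> \<Gamma> \<turnstile> Snd p \<Colon> sub_fm s B"
  using proves.AndE1 proves.AndE2 by simp_all

text \<open>
  The rules for formulas of the form \<open>sub_fm s A\<close> have to be tried first.
\<close>

lemmas typing = Hyp0 HypS Hyp0_map HypS_map ImpE_sub AndE_sub proves.TopI proves.AndI proves.AndE1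
  proves.AndE2 proves.ImpI proves.ImpE proves.AllI TApp_Var0

lemmas eval = subst0_def uptm_def shift_def

text \<open>The round trip turns f into the function with constant value f applied to
  \<open>Unit\<close>. Evaluation leaves the arguments \<open>Unit\<close> and \<open>Hyp 0\<close>
  to be compared, and these agree by eta for \<open>Top\<close> below the application.\<close>

lemma iso_Top_Imp: "iso (Imp Top A) A"
proof (rule isoI[where \<phi> = "Lam (App (Hyp 0) Unit)" and \<psi> = "Lam (Lam (Hyp (Suc 0)))"])
  fix \<Gamma>
  let ?u = "App (Lam (Lam (Hyp (Suc 0)))) (App (Lam (App (Hyp 0) Unit)) (Hyp 0)) :: 'a pt"
  assume "Imp Top A # \<Gamma> \<turnstile> ?u \<Colon> Imp Top A" "Imp Top A # \<Gamma> \<turnstile> Hyp 0 \<Colon> Imp Top A"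
  then show "Imp Top A # \<Gamma> \<turnstile> ?u \<approx> Hyp 0 \<Colon> Imp Top A"
  proof (rule ext_Imp')
    let ?G = "Top # Imp Top A # \<Gamma>" and ?v = "App (ren_pt Suc ?u) (Hyp 0)"
    have f: "?G \<turnstile> Hyp (Suc 0) \<Colon> Imp Top A" by (rule typing)+
    assume "?G \<turnstile> ?v \<Colon> A"
    then have "?G \<turnstile> ?v \<approx> App (Hyp (Suc 0)) Unit \<Colon> A"
      by (rule bee_by_dev) (rule proves.ImpE[OF f proves.TopI], simp add: eval)
    moreover have "?G \<turnstile> App (Hyp (Suc 0)) Unit \<approx> App (Hyp (Suc 0)) (Hyp 0) \<Colon> A"
      by (rule cong_App[OF bee_refl[OF f] ext_Top[OF proves.TopI Hyp0]])
    ultimately show "?G \<turnstile> ?v \<approx> App (ren_pt Suc (Hyp 0)) (Hyp 0) \<Colon> A"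
      by (simp add: bee_trans)
  qed
qed ((rule typing)+, rule bee_by_dev, assumption+, simp add: eval)

text \<open>Currying. Uncurrying a curried f feeds it the pair of the projections of its argument,
  so surjective pairing is used inside an argument, out of reach of evaluation.\<close>

lemma iso_Imp_Imp: "iso (Imp C (Imp D B)) (Imp (And C D) B)"
proof (rule isoI[where
      \<phi> = "Lam (Lam (App (App (Hyp (Suc 0)) (Fst (Hyp 0))) (Snd (Hyp 0))))" and
      \<psi> = "Lam (Lam (Lam (App (Hyp (Suc (Suc 0))) (MkPair (Hyp (Suc 0)) (Hyp 0)))))"])
  fix \<Gamma>
  let ?T = "Imp (And C D) B"
  let ?u = "App (Lam (Lam (App (App (Hyp (Suc 0)) (Fst (Hyp 0))) (Snd (Hyp 0)))))
    (App (Lam (Lam (Lam (App (Hyp (Suc (Suc 0))) (MkPair (Hyp (Suc 0)) (Hyp 0)))))) (Hyp 0)) :: 'a pt"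
  assume "?T # \<Gamma> \<turnstile> ?u \<Colon> ?T" "?T # \<Gamma> \<turnstile> Hyp 0 \<Colon> ?T"
  then show "?T # \<Gamma> \<turnstile> ?u \<approx> Hyp 0 \<Colon> ?T"
  proof (rule ext_Imp')
    let ?G = "And C D # ?T # \<Gamma>" and ?v = "App (ren_pt Suc ?u) (Hyp 0)"
    let ?p = "MkPair (Fst (Hyp 0)) (Snd (Hyp 0)) :: 'a pt"
    have f: "?G \<turnstile> Hyp (Suc 0) \<Colon> ?T" and p: "?G \<turnstile> ?p \<Colon> And C D" by (rule typing)+
    assume "?G \<turnstile> ?v \<Colon> B"
    then have "?G \<turnstile> ?v \<approx> App (Hyp (Suc 0)) ?p \<Colon> B"
      by (rule bee_by_dev) (rule proves.ImpE[OF f p], simp add: eval)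
    moreover have "?G \<turnstile> App (Hyp (Suc 0)) ?p \<approx> App (Hyp (Suc 0)) (Hyp 0) \<Colon> B"
      by (rule cong_App[OF bee_refl[OF f] bee_sym[OF eta_And[OF Hyp0]]])
    ultimately show "?G \<turnstile> ?v \<approx> App (ren_pt Suc (Hyp 0)) (Hyp 0) \<Colon> B"
      by (simp add: bee_trans)
  qed
qed ((rule typing)+, (rule ext_Imp', assumption+)+, rule bee_by_dev, assumption+, simp add: eval)

text \<open>Here and in the identities that follow, extensionality descends to \<open>Top\<close> or
  to an arbitrary subformula; at the latter, evaluation alone identifies both sides.\<close>

lemma iso_Top_And: "iso (And Top A) A"
  by (rule isoI[where
    \<phi> = "Lam (Snd (Hyp 0))" and
    \<psi> = "Lam (MkPair Unit (Hyp 0))"],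
    (rule typing)+,
    (rule ext_Top, assumption+ | rule ext_And', assumption+ | rule ext_Imp', assumption+ |
      rule ext_Forall', assumption+ | rule bee_by_dev, assumption+, simp add: eval)+)

lemma iso_And_Top: "iso (And A Top) A"
  by (rule isoI[where
    \<phi> = "Lam (Fst (Hyp 0))" and
    \<psi> = "Lam (MkPair (Hyp 0) Unit)"],
    (rule typing)+,
    (rule ext_Top, assumption+ | rule ext_And', assumption+ | rule ext_Imp', assumption+ |
      rule ext_Forall', assumption+ | rule bee_by_dev, assumption+, simp add: eval)+)

lemma iso_And_assoc: "iso (And (And A B) C) (And A (And B C))"
  by (rule isoI[where
    \<phi> = "Lam (MkPair (Fst (Fst (Hyp 0))) (MkPair (Snd (Fst (Hyp 0))) (Snd (Hyp 0))))" and
    \<psi> = "Lam (MkPair (MkPair (Fst (Hyp 0)) (Fst (Snd (Hyp 0)))) (Snd (Snd (Hyp 0))))"],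
    (rule typing)+,
    (rule ext_Top, assumption+ | rule ext_And', assumption+ | rule ext_Imp', assumption+ |
      rule ext_Forall', assumption+ | rule bee_by_dev, assumption+, simp add: eval)+)

lemma iso_Imp_Top: "iso (Imp C Top) Top"
  by (rule isoI[where
    \<phi> = "Lam Unit" and
    \<psi> = "Lam (Lam Unit)"],
    (rule typing)+,
    (rule ext_Top, assumption+ | rule ext_And', assumption+ | rule ext_Imp', assumption+ |
      rule ext_Forall', assumption+ | rule bee_by_dev, assumption+, simp add: eval)+)

lemma iso_Imp_And: "iso (Imp C (And A B)) (And (Imp C A) (Imp C B))"
  by (rule isoI[where
    \<phi> = "Lam (MkPair (Lam (Fst (App (Hyp (Suc 0)) (Hyp 0)))) (Lam (Snd (App (Hyp (Suc 0)) (Hyp 0)))))" and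
    \<psi> = "Lam (Lam (MkPair (App (Fst (Hyp (Suc 0))) (Hyp 0)) (App (Snd (Hyp (Suc 0))) (Hyp 0))))"],
    (rule typing)+,
    (rule ext_Top, assumption+ | rule ext_And', assumption+ | rule ext_Imp', assumption+ |
      rule ext_Forall', assumption+ | rule bee_by_dev, assumption+, simp add: eval)+)

lemma iso_Imp_Forall: "iso (Imp C (Forall A)) (Forall (Imp (sub_fm shift C) A))"
  by (rule isoI[where
    \<phi> = "Lam (TLam (Lam (TApp (App (Hyp (Suc 0)) (Hyp 0)) (Var 0))))" and
    \<psi> = "Lam (Lam (TLam (App (TApp (Hyp (Suc 0)) (Var 0)) (Hyp 0))))"],
    (rule typing)+,
    (rule ext_Top, assumption+ | rule ext_And', assumption+ | rule ext_Imp', assumption+ |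
      rule ext_Forall', assumption+ | rule bee_by_dev, assumption+, simp add: eval)+)

lemma iso_Forall_Top: "iso (Forall Top) Top"
  by (rule isoI[where
    \<phi> = "Lam Unit" and
    \<psi> = "Lam (TLam Unit)"],
    (rule typing)+,
    (rule ext_Top, assumption+ | rule ext_And', assumption+ | rule ext_Imp', assumption+ |
      rule ext_Forall', assumption+ | rule bee_by_dev, assumption+, simp add: eval)+)

lemma iso_Forall_And: "iso (Forall (And A B)) (And (Forall A) (Forall B))"
  by (rule isoI[where
    \<phi> = "Lam (MkPair (TLam (Fst (TApp (Hyp 0) (Var 0)))) (TLam (Snd (TApp (Hyp 0) (Var 0)))))" and
    \<psi> = "Lam (TLam (MkPair (TApp (Fst (Hyp 0)) (Var 0)) (TApp (Snd (Hyp 0)) (Var 0))))"],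
    (rule typing)+,
    (rule ext_Top, assumption+ | rule ext_And', assumption+ | rule ext_Imp', assumption+ |
      rule ext_Forall', assumption+ | rule bee_by_dev, assumption+, simp add: eval)+)

subsection \<open>Normal forms\<close>

abbreviation clause :: "nat \<times> ('f, 'p) fm \<times> ('f, 'p) fm \<Rightarrow> ('f, 'p) fm" where
  "clause \<equiv> \<lambda>(k, c, b). (Forall ^^ k) (Imp c b)"

text \<open>Any isomorphism followed by its inverse will do.\<close>

lemma iso_refl: "iso A A"
  by (rule iso_trans[OF iso_sym[OF iso_And_Top] iso_And_Top])

section \<open>Closure of the formula classes under substitution\<close>

lemma sub_fm_Disj: "cs \<noteq> [] \<Longrightarrow> sub_fm s (Disj cs) = Disj (map (sub_fm s) cs)"
  by (induction cs rule: Disj.induct) auto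

lemma sub_fm_Conj: "sub_fm s (Conj cs) = Conj (map (sub_fm s) cs)"
  by (induction cs rule: Conj.induct) auto

lemma sub_fm_Forall_funpow: "sub_fm s ((Forall ^^ k) A) = (Forall ^^ k) (sub_fm ((up ^^ k) s) A)"
  by (induction k arbitrary: s) (simp_all add: funpow_swap1[of up])

lemma sub_fm_Exists_funpow: "sub_fm s ((Exists ^^ k) A) = (Exists ^^ k) (sub_fm ((up ^^ k) s) A)"
  by (induction k arbitrary: s) (simp_all add: funpow_swap1[of up])

text \<open>Needed for premises that move under quantifiers. The induction is simultaneous over the
  classes and general in \<open>s\<close>, because a block of k quantifiers turns \<open>s\<close>
  into \<open>(up ^^ k) s\<close>.\<close>

lemma
  fixes d c b :: "('f, 'p) fm"
  shows SigmaF_sub: "d \<in> SigmaF \<Longrightarrow> sub_fm s d \<in> SigmaF"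
    and PiF_sub: "c \<in> PiF \<Longrightarrow> sub_fm s c \<in> PiF"
    and BaseF_sub: "b \<in> BaseF \<Longrightarrow> sub_fm s b \<in> BaseF"
proof (induction arbitrary: s and s and s rule: SigmaF_PiF_BaseF.inducts)
  case (Sigma_Disj cs)
  then show ?case
    by (subst sub_fm_Disj) (auto intro!: SigmaF_PiF_BaseF.Sigma_Disj)
next
  case (Pi_Conj ts)
  let ?f = "\<lambda>(k, c, b). (k, sub_fm ((up ^^ k) s) c, sub_fm ((up ^^ k) s) b)"
  have "sub_fm s (Conj (map clause ts)) =
      Conj (map clause (map ?f ts))"
    by (simp add: sub_fm_Conj sub_fm_Forall_funpow comp_def case_prod_beta)
  also have "\<dots> \<in> PiF"
    using Pi_Conj by (intro SigmaF_PiF_BaseF.Pi_Conj) auto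
  finally show ?case .
next
  case (Base_Prime P us)
  show ?case by (simp add: SigmaF_PiF_BaseF.Base_Prime)
next
  case (Base_Sigma d)
  then show ?case by (simp add: SigmaF_PiF_BaseF.Base_Sigma)
next
  case (Base_Exists c k)
  then show ?case by (simp add: sub_fm_Exists_funpow SigmaF_PiF_BaseF.Base_Exists)
qed

section \<open>Iterated conjunctions up to isomorphism\<close>

text \<open>\<open>Conj [A]\<close> is \<open>A\<close> and not \<open>And A Top\<close>, so the
  uniform recursion over lists holds only up to isomorphism.\<close>

lemma iso_Conj_Cons: "iso (Conj (A # As)) (And A (Conj As))"
  by (cases As) (auto intro: iso_refl iso_sym[OF iso_And_Top])

lemma iso_Conj_append: "iso (And (Conj As) (Conj Bs)) (Conj (As @ Bs))"
proof (induction As)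
  case Nil
  show ?case by (simp add: iso_Top_And)
next
  case (Cons A As)
  have "iso (And (Conj (A # As)) (Conj Bs)) (And (And A (Conj As)) (Conj Bs))"
    by (rule iso_And[OF iso_Conj_Cons iso_refl])
  also note iso_And_assoc
  also have "iso (And A (And (Conj As) (Conj Bs))) (And A (Conj (As @ Bs)))"
    by (rule iso_And[OF iso_refl Cons.IH])
  also have "iso (And A (Conj (As @ Bs))) (Conj (A # As @ Bs))"
    by (rule iso_sym[OF iso_Conj_Cons])
  finally show ?case by simp
qed

text \<open>A functor preserving the nullary and the binary product preserves iterated ones;
  \<open>f\<close> will be \<open>Imp C\<close> and \<open>Forall\<close>.\<close>

lemma iso_map_Conj:
  assumes cong: "\<And>A B. iso A B \<Longrightarrow> iso (f A) (f B)"
    and Top: "iso (f Top) Top" and And: "\<And>A B. iso (f (And A B)) (And (f A) (f B))"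
  shows "iso (f (Conj As)) (Conj (map f As))"
proof (induction As)
  case Nil
  show ?case by (simp add: Top)
next
  case (Cons A As)
  have "iso (f (Conj (A # As))) (f (And A (Conj As)))"
    by (rule cong[OF iso_Conj_Cons])
  also note And
  also have "iso (And (f A) (f (Conj As))) (And (f A) (Conj (map f As)))"
    by (rule iso_And[OF iso_refl Cons.IH])
  also have "iso (And (f A) (Conj (map f As))) (Conj (f A # map f As))"
    by (rule iso_sym[OF iso_Conj_Cons])
  finally show ?case by simp
qed

lemma iso_Imp_Conj: "iso (Imp C (Conj As)) (Conj (map (Imp C) As))"
  by (rule iso_map_Conj[OF iso_Imp[OF iso_refl] iso_Imp_Top iso_Imp_And])

lemma iso_Forall_Conj: "iso (Forall (Conj As)) (Conj (map Forall As))"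
  by (rule iso_map_Conj[OF iso_Forall iso_Forall_Top iso_Forall_And])

lemma iso_Forall_funpow: "iso A B \<Longrightarrow> iso ((Forall ^^ k) A) ((Forall ^^ k) B)"
  by (induction k) (auto intro: iso_Forall)

text \<open>The premise passes the quantifiers one at a time, shifted at each, and is finally merged
  with D by uncurrying.\<close>

lemma iso_Imp_clause:
  "iso (Imp C ((Forall ^^ k) (Imp D B))) ((Forall ^^ k) (Imp (And ((sub_fm shift ^^ k) C) D) B))"
proof (induction k arbitrary: C)
  case 0
  show ?case by (simp add: iso_Imp_Imp)
next
  case (Suc k)
  show ?case
    using iso_trans[OF iso_Imp_Forall iso_Forall[OF Suc.IH]] by (simp add: funpow_swap1)
qed

section \<open>Closure of the normalisable formulas under the connectives\<close>

definition good :: "('f, 'p) fm \<Rightarrow> bool" where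
  "good A \<longleftrightarrow> (\<exists>c \<in> PiF. iso A c)"

lemma good_iso: "iso A B \<Longrightarrow> good B \<Longrightarrow> good A"
  unfolding good_def using iso_trans by blast

lemma good_PiF: "c \<in> PiF \<Longrightarrow> good c"
  unfolding good_def using iso_refl by blast

lemma Top_PiF: "Top \<in> PiF"
  using Pi_Conj[of "[]"] by simp

lemma clause_PiF: "c \<in> PiF \<Longrightarrow> b \<in> BaseF \<Longrightarrow> (Forall ^^ k) (Imp c b) \<in> PiF"
  using Pi_Conj[of "[(k, c, b)]"] by simp

lemma PiF_E:
  assumes "c \<in> PiF"
  obtains ts where "c = Conj (map clause ts)"
    "\<And>k c b. (k, c, b) \<in> set ts \<Longrightarrow> c \<in> PiF \<and> b \<in> BaseF"
  using assms by (cases rule: PiF.cases) blast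

lemma good_BaseF: "b \<in> BaseF \<Longrightarrow> good b"
proof -
  assume "b \<in> BaseF"
  \<comment> \<open>The block of quantifiers is empty, k = 0.\<close>
  then have "good (Imp Top b)" using good_PiF[OF clause_PiF[OF Top_PiF, of b 0]] by simp
  then show ?thesis by (rule good_iso[OF iso_sym[OF iso_Top_Imp]])
qed

lemma good_And:
  assumes "good A" "good B"
  shows "good (And A B)"
proof -
  from assms obtain c d where c: "c \<in> PiF" "iso A c" and d: "d \<in> PiF" "iso B d"
    unfolding good_def by blast
  obtain ts where ts: "c = Conj (map clause ts)"
    "\<And>k c b. (k, c, b) \<in> set ts \<Longrightarrow> c \<in> PiF \<and> b \<in> BaseF"
    using c(1) by (rule PiF_E) blast
  obtain us where us: "d = Conj (map clause us)"
    "\<And>k c b. (k, c, b) \<in> set us \<Longrightarrow> c \<in> PiF \<and> b \<in> BaseF"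
    using d(1) by (rule PiF_E) blast
  have "iso (And A B) (Conj (map clause (ts @ us)))"
    using iso_trans[OF iso_And[OF c(2) d(2)]] iso_Conj_append unfolding ts(1) us(1) map_append by blast
  moreover have "Conj (map clause (ts @ us)) \<in> PiF"
    using ts(2) us(2) by (intro Pi_Conj) auto
  ultimately show ?thesis unfolding good_def by blast
qed

lemma good_Conj: "(\<And>A. A \<in> set As \<Longrightarrow> good A) \<Longrightarrow> good (Conj As)"
proof (induction As)
  case Nil
  show ?case by (simp add: good_PiF Top_PiF)
next
  case (Cons A As)
  then show ?case by (intro good_iso[OF iso_Conj_Cons] good_And) auto
qed

lemma good_Imp:
  assumes "good A" "good B"
  shows "good (Imp A B)"
proof -
  from assms obtain c d where c: "c \<in> PiF" "iso A c" and d: "d \<in> PiF" "iso B d"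
    unfolding good_def by blast
  obtain ts where ts: "d = Conj (map clause ts)"
    "\<And>k c b. (k, c, b) \<in> set ts \<Longrightarrow> c \<in> PiF \<and> b \<in> BaseF"
    using d(1) by (rule PiF_E) blast
  have "good (Imp c ((Forall ^^ k) (Imp e b)))" if "(k, e, b) \<in> set ts" for k e b
  proof -
    \<comment> \<open>The merged premise is a conjunction of two members of \<open>PiF\<close>, not
      literally a member; \<open>good_And\<close> flattens it to \<open>e'\<close>.\<close>
    have "(sub_fm shift ^^ k) c \<in> PiF" using c(1) by (induction k) (auto intro: PiF_sub)
    with ts(2)[OF that] obtain e' where e': "e' \<in> PiF" "iso (And ((sub_fm shift ^^ k) c) e) e'"
      using good_And good_PiF unfolding good_def by blast
    have "iso (Imp c ((Forall ^^ k) (Imp e b))) ((Forall ^^ k) (Imp e' b))"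
      by (rule iso_trans[OF iso_Imp_clause iso_Forall_funpow[OF iso_Imp[OF e'(2) iso_refl]]])
    then show ?thesis
      by (rule good_iso) (rule good_PiF[OF clause_PiF[OF e'(1)]], use ts(2)[OF that] in blast)
  qed
  then have "good (Conj (map (Imp c) (map clause ts)))"
    by (intro good_Conj) auto
  then have "good (Imp c d)"
    unfolding ts(1) by (rule good_iso[OF iso_Imp_Conj])
  then show ?thesis by (rule good_iso[OF iso_Imp[OF c(2) d(2)]])
qed

lemma good_Forall:
  assumes "good A"
  shows "good (Forall A)"
proof -
  from assms obtain c where c: "c \<in> PiF" "iso A c"
    unfolding good_def by blast
  obtain ts where ts: "c = Conj (map clause ts)"
    "\<And>k c b. (k, c, b) \<in> set ts \<Longrightarrow> c \<in> PiF \<and> b \<in> BaseF"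
    using c(1) by (rule PiF_E) blast
  have "good (Forall ((Forall ^^ k) (Imp e b)))" if "(k, e, b) \<in> set ts" for k e b
    \<comment> \<open>The new quantifier joins the block of the clause.\<close>
    using good_PiF[OF clause_PiF[of e b "Suc k"]] ts(2)[OF that] by simp
  then have "good (Conj (map Forall (map clause ts)))"
    by (intro good_Conj) auto
  then have "good (Forall c)"
    unfolding ts(1) by (rule good_iso[OF iso_Forall_Conj])
  then show ?thesis by (rule good_iso[OF iso_Forall[OF c(2)]])
qed

lemma good: "good A"
proof (induction A)
  case (Prime P us)
  show ?case by (rule good_BaseF[OF Base_Prime])
next
  case Top
  show ?case by (rule good_PiF[OF Top_PiF])
next
  case (Or A B)
  then obtain c d where cd: "c \<in> PiF" "d \<in> PiF" and iso: "iso (Or A B) (Or c d)"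
    unfolding good_def using iso_Or by blast
  \<comment> \<open>The outermost connective of a member of \<open>PiF\<close> is never a
    disjunction, so a nested disjunction stays inside a disjunct, and the two-element list is
    already admissible.\<close>
  have "Or c d \<in> BaseF" using Base_Sigma[OF Sigma_Disj[of "[c, d]"]] cd by simp
  then show ?case by (rule good_iso[OF iso good_BaseF])
next
  case (Exists A)
  then obtain c where c: "c \<in> PiF" and iso: "iso (Exists A) (Exists c)"
    unfolding good_def using iso_Exists by blast
  have "Exists c \<in> BaseF" using Base_Exists[OF c, of 1] by simp
  then show ?case by (rule good_iso[OF iso good_BaseF])
qed (auto intro: good_And good_Imp good_Forall)

theorem theorem12:
  fixes F :: "('f, 'p) fm"
  assumes "top_free F"
  shows "\<exists>e \<in> SigmaF \<union> PiF. F \<cong> e"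
  using good[of F] iso_imp_isomorphic unfolding good_def by blast

end
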